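(* Let $h(z)$ be an entire function of exponential type $\tau$ whose restriction $h(x)$ to the real line is absolutely integrable on $[0,\infty)$, i.e. $\int_0^\infty |h(x)|\,\mathrm{d}x<\infty$. Let $l$ be a non-negative integer and let $J_{2l+1}$ be the Bessel function of the first kind of order $2l+1$. Suppose that $h$ has the expansion $$h(z)=z^{2m}\sum_{j=0}^{\infty}b_j z^{2j},$$ where $b_0\neq 0$ and $m$ is an integer with $m+l\geq 0$. If $\lambda>\tau$, then $$\int_0^\infty h(x)\,J_{2l+1}(\lambda x)\,\mathrm{d}x=0\qquad\text{when } l<m,$$ and $$\int_0^\infty h(x)\,J_{2l+1}(\lambda x)\,\mathrm{d}x=\frac12\sum_{j=0}^{l-m}b_j\,\frac{(l+m+j)!}{(l-m-j)!}\left(\frac{2}{\lambda}\right)^{2m+2j+1}\qquad\text{when } l\geq m.$$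
   Context: An entire function $h:\mathbb{C}\to\mathbb{C}$ is said to be of exponential type $\tau$ (with $\tau\ge 0$ real) if for every (arbitrarily small) $\epsilon>0$ the inequality $|h(z)|\leq e^{(\tau+\epsilon)|z|}$ holds for all sufficiently large $|z|$ (with threshold depending on $\epsilon$). The parameter $\lambda$ is a positive real number. *)

theory Defs
  imports "HOL-Complex_Analysis.Complex_Analysis"
begin

definition entire_of_exp_type :: "(complex \<Rightarrow> complex) \<Rightarrow> real \<Rightarrow> bool" where
  "entire_of_exp_type h \<tau> \<longleftrightarrow>
     h holomorphic_on UNIV \<and> 0 \<le> \<tau> \<and>
     (\<forall>\<epsilon>>0. \<forall>\<^sub>F z in at_infinity. norm (h z) \<le> exp ((\<tau> + \<epsilon>) * norm z))"

(* Natural-number order only, so that (k + n)! takes the place of Gamma (k + n + 1)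
   and no branch of a complex power is involved. *)
definition bessel_J :: "nat \<Rightarrow> complex \<Rightarrow> complex" where
  "bessel_J n z = (\<Sum>k. (-1) ^ k / (fact k * fact (k + n)) * (z / 2) ^ (2 * k + n))"

lemma summable_bessel_J:
  "summable (\<lambda>k. (-1) ^ k / (fact k * fact (k + n)) * (z / 2) ^ (2 * k + n) :: complex)"
proof (rule summable_comparison_test)
  define w where "w = (norm z / 2)\<^sup>2"
  have "norm ((-1) ^ k / (fact k * fact (k + n)) * (z / 2) ^ (2 * k + n) :: complex)
          \<le> (norm z / 2) ^ n * (inverse (fact k) * w ^ k)" for k
  proof -
    have "1 / (fact k * fact (k + n)) \<le> (1 / fact k :: real)"
      by (simp add: field_simps fact_ge_1)
    hence "1 / (fact k * fact (k + n)) * (norm z / 2) ^ (2 * k + n)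
             \<le> 1 / fact k * (norm z / 2) ^ (2 * k + n)"
      by (intro mult_right_mono) auto
    moreover have "norm ((-1) ^ k / (fact k * fact (k + n)) * (z / 2) ^ (2 * k + n) :: complex)
        = 1 / (fact k * fact (k + n)) * (norm z / 2) ^ (2 * k + n)"
      by (simp add: norm_mult norm_divide norm_power)
    moreover have "1 / fact k * (norm z / 2) ^ (2 * k + n)
        = (norm z / 2) ^ n * (inverse (fact k) * w ^ k)"
      unfolding w_def power_add power_mult by (simp only: divide_inverse mult_1_left mult_ac)
    ultimately show ?thesis
      by simp
  qed
  thus "\<exists>N. \<forall>k\<ge>N. norm ((-1) ^ k / (fact k * fact (k + n)) * (z / 2) ^ (2 * k + n) :: complex)
          \<le> (norm z / 2) ^ n * (inverse (fact k) * w ^ k)"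
    by blast
  show "summable (\<lambda>k. (norm z / 2) ^ n * (inverse (fact k) * w ^ k))"
    by (intro summable_mult summable_exp)
qed

end

theory Submission
  imports Defs "HOL-Real_Asymp.Real_Asymp"
begin

text \<open>
  Put \<open>L s = \<integral>\<^sub>0\<^sup>\<infinity> exp (- s x) J\<^sub>n(\<lambda>x) dx\<close>. In closed form,
  \<open>L s = (q - s)\<^sup>n / (\<lambda>\<^sup>n q)\<close> with \<open>q = csqrt (s\<^sup>2 + \<lambda>\<^sup>2)\<close>, which continues analytically to the strip
  \<open>\<bar>Im s\<bar> < \<lambda>\<close>. Write \<open>h(x) = \<Sum>\<^sub>k c\<^sub>k x\<^sup>k\<close>. For large real \<open>s\<close> the sum may be integrated termwise,
  so \<open>\<integral>\<^sub>0\<^sup>\<infinity> exp (- s x) h(x) J\<^sub>n(\<lambda>x) dx = \<Sum>\<^sub>k c\<^sub>k (-1)\<^sup>k (deriv ^^ k) L s\<close>. The left side is holomorphic for \<open>Re s > 0\<close>.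
  Since \<open>\<bar>c\<^sub>k\<bar> k!\<close> grows like \<open>\<rho>\<^sup>k\<close> with \<open>\<tau> < \<rho> < \<lambda>\<close>, Cauchy's inequality on circles of radius between
  \<open>\<rho>\<close> and \<open>\<lambda>\<close> makes the right side holomorphic in a thin strip around the real axis. So the identity
  persists down to \<open>s = 0\<close>. There the differential equation \<open>(s\<^sup>2 + \<lambda>\<^sup>2) L'' + 3 s L' + (1 - n\<^sup>2) L = 0\<close>
  yields a recursion for the derivatives; for \<open>n = 2l + 1\<close> those of even order vanish from order \<open>2l + 2\<close> on.
\<close>

section \<open>Moments of exponentials and termwise integration on the half-line\<close>

lemma absolutely_integrable_bounded_continuous_mult:
  fixes f g :: "real \<Rightarrow> complex"
  assumes f: "f absolutely_integrable_on {0..}"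
    and g: "continuous_on {0..} g" and B: "\<And>x. 0 \<le> x \<Longrightarrow> norm (g x) \<le> B"
  shows "(\<lambda>x. g x * f x) absolutely_integrable_on {0..}"
proof (rule absolutely_integrable_bounded_measurable_product[OF bilinear_times _ _ _ f])
  show "g \<in> borel_measurable (lebesgue_on {0..})"
    by (intro continuous_imp_measurable_on_sets_lebesgue g) auto
  show "bounded (g ` {0..})"
    using B by (auto simp: bounded_iff)
qed auto

text \<open>Integration by parts on \<open>{0..y}\<close> gives a recursion in \<open>k\<close>, and
  its boundary term vanishes as \<open>y\<close> tends to infinity.\<close>

lemma has_integral_power_times_exp:
  fixes s :: real
  assumes s: "0 < s"
  shows "((\<lambda>x. x ^ k * exp (- s * x)) has_integral (fact k / s ^ Suc k)) {0..}"
proof (rule has_integral_to_inf)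
  show "(\<lambda>x. x ^ k * exp (- s * x)) integrable_on {0..y}" for y
    by (intro integrable_continuous_interval continuous_intros)
  show "((\<lambda>y. integral {0..y} (\<lambda>x. x ^ k * exp (- s * x))) \<longlongrightarrow> fact k / s ^ Suc k) at_top"
  proof (induction k)
    case 0
    have "\<forall>\<^sub>F y in at_top. 1 / s - exp (- s * y) / s = integral {0..y} (\<lambda>x. x ^ 0 * exp (- s * x))"
    proof (intro eventually_at_top_linorderI[of 0] integral_unique[symmetric])
      fix y :: real assume "0 \<le> y"
      then have "((\<lambda>x. exp (- s * x)) has_integral (- exp (- s * y) / s - (- exp (- s * 0) / s))) {0..y}"
        using s by (intro fundamental_theorem_of_calculus)
          (auto intro!: derivative_eq_intros simp flip: has_real_derivative_iff_has_vector_derivative)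
      then show "((\<lambda>x. x ^ 0 * exp (- s * x)) has_integral (1 / s - exp (- s * y) / s)) {0..y}"
        by simp
    qed
    moreover have "((\<lambda>y. 1 / s - exp (- s * y) / s) \<longlongrightarrow> 1 / s) at_top"
      using s by real_asymp
    ultimately show ?case by (simp add: tendsto_cong)
  next
    case (Suc k)
    let ?I = "\<lambda>k y. integral {0..y} (\<lambda>x. x ^ k * exp (- s * x))"
    have "\<forall>\<^sub>F y in at_top. real (Suc k) / s * ?I k y - y ^ Suc k * exp (- s * y) / s = ?I (Suc k) y"
    proof (intro eventually_at_top_linorderI[of 0])
      fix y :: real assume "0 \<le> y"
      have deriv: "((\<lambda>x. - (x ^ Suc k * exp (- s * x) / s)) has_real_derivative
          (x ^ Suc k * exp (- s * x) - real (Suc k) / s * (x ^ k * exp (- s * x)))) (at x within {0..y})" for x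
        using s by (auto intro!: derivative_eq_intros simp: divide_simps algebra_simps simp del: power_Suc)
      have i1: "((\<lambda>x. x ^ Suc k * exp (- s * x) - real (Suc k) / s * (x ^ k * exp (- s * x)))
          has_integral (- (y ^ Suc k * exp (- s * y) / s) - (- (0 ^ Suc k * exp (- s * 0) / s)))) {0..y}"
        using \<open>0 \<le> y\<close> deriv
        by (intro fundamental_theorem_of_calculus) (auto simp: has_real_derivative_iff_has_vector_derivative)
      have i2: "((\<lambda>x. real (Suc k) / s * (x ^ k * exp (- s * x))) has_integral (real (Suc k) / s * ?I k y)) {0..y}"
        by (intro has_integral_mult_right integrable_integral integrable_continuous_interval continuous_intros)
      have "((\<lambda>x. x ^ Suc k * exp (- s * x)) has_integral
          (real (Suc k) / s * ?I k y - y ^ Suc k * exp (- s * y) / s)) {0..y}"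
        using has_integral_add[OF i1 i2] by simp
      then show "real (Suc k) / s * ?I k y - y ^ Suc k * exp (- s * y) / s = ?I (Suc k) y"
        by (simp add: integral_unique)
    qed
    moreover have "((\<lambda>y. real (Suc k) / s * ?I k y - y ^ Suc k * exp (- s * y) / s)
        \<longlongrightarrow> real (Suc k) / s * (fact k / s ^ Suc k) - 0) at_top"
    proof (intro tendsto_diff tendsto_mult_left Suc.IH)
      show "((\<lambda>y. y ^ Suc k * exp (- s * y) / s) \<longlongrightarrow> 0) at_top"
        using s by real_asymp
    qed
    ultimately show ?case by (simp add: tendsto_cong mult.commute)
  qed
qed auto

text \<open>Comparison with the exponential series bounds every partial sum by
  \<open>C * exp (\<rho> * x)\<close>, so the weighted function in the first hypothesis is an
  integrable majorant and dominated convergence applies. All later exchanges of a sum with an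
  integral over the half-line rest on this.\<close>

lemma sums_integral_moments:
  fixes f :: "real \<Rightarrow> complex" and c :: "nat \<Rightarrow> complex"
  assumes f: "(\<lambda>x. of_real (exp (\<rho> * x)) * f x) absolutely_integrable_on {0..}"
    and \<rho>: "0 < \<rho>" and c: "\<And>k. norm (c k) * fact k \<le> C * \<rho> ^ k"
  shows "(\<lambda>x. of_real x ^ k * f x) absolutely_integrable_on {0..}"
    and "(\<lambda>k. c k * integral {0..} (\<lambda>x. of_real x ^ k * f x)) sums
            integral {0..} (\<lambda>x. (\<Sum>k. c k * of_real x ^ k) * f x)" (is ?sums)
proof -
  have exp_sums: "(\<lambda>k. (\<rho> * x) ^ k / fact k) sums exp (\<rho> * x)" for x
    using exp_converges[of "\<rho> * x"] by (simp add: divide_inverse mult.commute)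
  have exp_ge: "(\<rho> * x) ^ k / fact k \<le> exp (\<rho> * x)" if "0 \<le> x" for x k
    using that \<rho> exp_sums[of x] sum_le_suminf[of "\<lambda>k. (\<rho> * x) ^ k / fact k" "{k}"]
    by (simp add: sums_iff)
  show int: "(\<lambda>x. of_real x ^ k * f x) absolutely_integrable_on {0..}" for k
  proof -
    \<comment> \<open>Inserting \<open>exp (- \<rho> * x) * exp (\<rho> * x) = 1\<close> leaves a
      bounded factor in front of the weighted function.\<close>
    have "(\<lambda>x. (of_real x ^ k * of_real (exp (- \<rho> * x))) * (of_real (exp (\<rho> * x)) * f x)) absolutely_integrable_on {0..}"
    proof (rule absolutely_integrable_bounded_continuous_mult[OF f])
      fix x :: real assume x: "0 \<le> x"
      have "\<rho> ^ k * x ^ k \<le> fact k * exp (\<rho> * x)"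
        using exp_ge[OF x, of k] by (simp add: field_simps power_mult_distrib)
      then have "x ^ k * exp (- \<rho> * x) \<le> fact k / \<rho> ^ k"
        using \<rho> by (simp add: field_simps exp_minus)
      then show "norm (complex_of_real x ^ k * of_real (exp (- \<rho> * x))) \<le> fact k / \<rho> ^ k"
        using x by (simp add: norm_mult norm_power)
    qed (intro continuous_intros)
    moreover have "(of_real x ^ k * complex_of_real (exp (- \<rho> * x))) * (of_real (exp (\<rho> * x)) * f x) = of_real x ^ k * f x" for x
    proof -
      have "complex_of_real (exp (- \<rho> * x)) * of_real (exp (\<rho> * x)) = 1"
        by (simp flip: of_real_mult exp_add)
      then show ?thesis by (simp add: mult.assoc)
    qed
    ultimately show ?thesis by (simp only:)
  qed
  have "norm (c 0) \<le> C" using c[of 0] by simp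
  then have C: "0 \<le> C" using norm_ge_zero order_trans by blast
  have bound: "norm (c k * of_real x ^ k) \<le> C * ((\<rho> * x) ^ k / fact k)" if "0 \<le> x" for x k
  proof -
    have "norm (c k) * fact k * x ^ k \<le> C * \<rho> ^ k * x ^ k"
      by (intro mult_right_mono c) (use that in auto)
    then show ?thesis using that by (simp add: norm_mult norm_power field_simps power_mult_distrib)
  qed
  have dom: "norm (\<Sum>k<N. c k * of_real x ^ k) \<le> C * exp (\<rho> * x)" if "0 \<le> x" for x N
  proof -
    have "norm (\<Sum>k<N. c k * of_real x ^ k) \<le> (\<Sum>k<N. C * ((\<rho> * x) ^ k / fact k))"
      by (intro sum_norm_le bound that)
    also have "\<dots> \<le> C * exp (\<rho> * x)"
      unfolding sum_distrib_left[symmetric] sums_unique[OF exp_sums]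
      by (intro mult_left_mono sum_le_suminf) (use C \<rho> that exp_sums in \<open>auto simp: sums_iff\<close>)
    finally show ?thesis .
  qed
  have conv: "(\<lambda>k. c k * of_real x ^ k) sums (\<Sum>k. c k * of_real x ^ k)" if "0 \<le> x" for x
  proof (rule summable_sums, rule summable_comparison_test)
    show "\<exists>N. \<forall>k\<ge>N. norm (c k * of_real x ^ k) \<le> C * ((\<rho> * x) ^ k / fact k)"
      using bound[OF that] by blast
    show "summable (\<lambda>k. C * ((\<rho> * x) ^ k / fact k))"
      by (intro summable_mult sums_summable[OF exp_sums])
  qed
  let ?P = "\<lambda>N x. (\<Sum>k<N. c k * of_real x ^ k) * f x"
  have Pint: "((\<lambda>x. ?P N x) has_integral (\<Sum>k<N. c k * integral {0..} (\<lambda>x. of_real x ^ k * f x))) {0..}" for N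
    unfolding sum_distrib_right mult.assoc
    by (intro has_integral_sum has_integral_mult_right integrable_integral
          set_lebesgue_integral_eq_integral(1) int) auto
  have dint: "(\<lambda>x. C * norm (of_real (exp (\<rho> * x)) * f x)) integrable_on {0..}"
    by (intro integrable_on_mult_right) (use f in \<open>auto simp: absolutely_integrable_on_def\<close>)
  have le: "norm (?P N x) \<le> C * norm (of_real (exp (\<rho> * x)) * f x)" if "x \<in> {0..}" for N x
    using mult_right_mono[OF dom[of x N] norm_ge_zero[of "f x"]] that by (simp add: norm_mult)
  have lim: "(\<lambda>N. ?P N x) \<longlonglongrightarrow> (\<Sum>k. c k * of_real x ^ k) * f x" if "x \<in> {0..}" for x
    using conv[of x] that unfolding sums_def by (intro tendsto_intros) auto
  note dc = dominated_convergence[OF has_integral_integrable[OF Pint] dint le lim]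
  show ?sums unfolding sums_def using dc(2) by (simp add: integral_unique[OF Pint])
qed

subsection \<open>The Laplace transform on the half-line\<close>

definition laplace :: "(real \<Rightarrow> complex) \<Rightarrow> complex \<Rightarrow> complex" where
  "laplace f s = integral {0..} (\<lambda>x. exp (- s * of_real x) * f x)"

lemma laplace_absolutely_integrable:
  assumes f: "f absolutely_integrable_on {0..}" and s: "0 \<le> Re s"
  shows "(\<lambda>x. exp (- s * of_real x) * f x) absolutely_integrable_on {0..}"
proof (rule absolutely_integrable_bounded_continuous_mult[OF f])
  show "norm (exp (- s * of_real x)) \<le> 1" if "0 \<le> x" for x
    using s that by simp
qed (intro continuous_intros)

text \<open>The factor \<open>exp (- (w - s) * x)\<close> is expanded in powers of \<open>x\<close>.
  On the disc of radius \<open>Re s\<close> about \<open>s\<close> the decay of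
  \<open>exp (- s * x)\<close> compensates the growth of that series.\<close>

lemma laplace_sums:
  assumes f: "f absolutely_integrable_on {0..}" and s: "norm (w - s) < Re s"
  shows "(\<lambda>k. (- 1) ^ k / fact k * integral {0..} (\<lambda>x. of_real x ^ k * (exp (- s * of_real x) * f x)) * (w - s) ^ k)
           sums laplace f w"
proof -
  \<comment> \<open>Any positive value from \<open>norm (w - s)\<close> to \<open>Re s\<close>
    serves: the lower bound controls the coefficients, the upper one keeps the weighted integrand
    absolutely integrable.\<close>
  define \<rho> where "\<rho> = (norm (w - s) + Re s) / 2"
  have \<rho>: "norm (w - s) \<le> \<rho>" "\<rho> \<le> Re s" "0 < \<rho>"
    using s norm_ge_zero[of "w - s"] by (auto simp: \<rho>_def simp del: norm_ge_zero)
  define c where "c = (\<lambda>k. (- (w - s)) ^ k / fact k)"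
  have c: "norm (c k) * fact k \<le> 1 * \<rho> ^ k" for k
    using \<rho> by (auto simp: c_def norm_divide norm_power norm_minus_commute intro!: power_mono)
  have int: "(\<lambda>x. of_real (exp (\<rho> * x)) * (exp (- s * of_real x) * f x)) absolutely_integrable_on {0..}"
  proof -
    have "(\<lambda>x. exp (- (s - of_real \<rho>) * of_real x) * f x) absolutely_integrable_on {0..}"
      by (rule laplace_absolutely_integrable[OF f]) (use \<rho> in auto)
    moreover have "exp (- (s - of_real \<rho>) * of_real x) * f x = of_real (exp (\<rho> * x)) * (exp (- s * of_real x) * f x)" for x
      by (simp add: exp_of_real[symmetric] mult_exp_exp algebra_simps)
    ultimately show ?thesis by (simp only:)
  qed
  have "(\<Sum>k. c k * of_real x ^ k) * (exp (- s * of_real x) * f x) = exp (- w * of_real x) * f x" for x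
  proof -
    have "(\<lambda>k. c k * of_real x ^ k) sums exp (- (w - s) * of_real x)"
      using exp_converges[of "- (w - s) * of_real x"]
      unfolding c_def power_mult_distrib by (simp add: scaleR_conv_of_real field_simps)
    then show ?thesis by (simp add: sums_iff mult_exp_exp algebra_simps flip: mult.assoc)
  qed
  with sums_integral_moments(2)[OF int \<rho>(3) c]
  have "(\<lambda>k. c k * integral {0..} (\<lambda>x. of_real x ^ k * (exp (- s * of_real x) * f x))) sums laplace f w"
    unfolding laplace_def by (simp only:)
  moreover have "c k = (- 1) ^ k / fact k * (w - s) ^ k" for k
    unfolding c_def power_minus[of "w - s"] by simp
  ultimately show ?thesis by (simp add: mult_ac)
qed

text \<open>The discs \<open>ball s (Re s)\<close>, on each of which a power series represents the
  transform, cover the half-plane.\<close>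

lemma laplace_holomorphic:
  assumes f: "f absolutely_integrable_on {0..}"
  shows "laplace f holomorphic_on {s. 0 < Re s}"
proof -
  have "laplace f holomorphic_on ball s (Re s)" for s
    by (rule power_series_holomorphic) (rule laplace_sums[OF f], simp add: dist_norm norm_minus_commute)
  moreover have "s \<in> ball s (Re s)" if "0 < Re s" for s using that by simp
  ultimately have "laplace f analytic_on {s}" if "0 < Re s" for s
    using that analytic_at open_ball by blast
  then show ?thesis
    by (intro analytic_imp_holomorphic) (subst analytic_on_analytic_at, auto)
qed

text \<open>Differentiation under the integral sign, obtained by reading off the Taylor coefficients
  in \<open>laplace_sums\<close>.\<close>

lemma higher_deriv_laplace:
  assumes f: "f absolutely_integrable_on {0..}" and s: "0 < Re s"
  shows "(deriv ^^ k) (laplace f) s =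
           (- 1) ^ k * integral {0..} (\<lambda>x. of_real x ^ k * (exp (- s * of_real x) * f x))"
proof -
  define F where "F = Abs_fps (\<lambda>k. (- 1) ^ k / fact k * integral {0..} (\<lambda>x. of_real x ^ k * (exp (- s * of_real x) * f x)))"
  have "(laplace f \<circ> (+) s) has_fps_expansion F"
  proof (rule has_fps_expansionI)
    have "eventually (\<lambda>u. u \<in> ball 0 (Re s)) (nhds (0 :: complex))"
      using s by (intro eventually_nhds_in_open) auto
    then show "eventually (\<lambda>u. (\<lambda>n. fps_nth F n * u ^ n) sums (laplace f \<circ> (+) s) u) (nhds 0)"
    proof eventually_elim
      case (elim u)
      then show ?case using laplace_sums[OF f, of "s + u" s] by (simp add: F_def)
    qed
  qed
  from fps_nth_fps_expansion[OF this, of k]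
  have "(deriv ^^ k) (laplace f \<circ> (+) s) 0 = fact k * fps_nth F k" by simp
  then show ?thesis
    by (subst higher_deriv_shift_0) (simp add: F_def)
qed

subsection \<open>Bessel functions as contour integrals\<close>

text \<open>The coefficient of \<open>w\<^sup>n\<close> in \<open>(w - 1/w)\<^sup>k\<close>, so that \<open>J\<^sub>n(z) = \<Sum>\<^sub>k bessel_coeff n k (z/2)\<^sup>k / k!\<close>
  by the generating function of the Bessel functions.\<close>
definition bessel_coeff :: "nat \<Rightarrow> nat \<Rightarrow> complex" where
  "bessel_coeff n k = fps_nth ((1 - fps_X ^ 2) ^ k * fps_X ^ n) k"

lemma fps_nth_one_minus_X_square_power:
  "fps_nth ((1 - fps_X ^ 2) ^ k) (2 * j) = ((- 1) ^ j * of_nat (k choose j) :: complex)"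
  "odd m \<Longrightarrow> fps_nth ((1 - fps_X ^ 2) ^ k) m = (0 :: complex)"
proof -
  have eq: "(1 - fps_X ^ 2 :: complex fps) ^ k =
      (\<Sum>i\<le>k. fps_const (of_nat (k choose i) * (- 1) ^ i) * fps_X ^ (2 * i))"
    using binomial_ring[of "- (fps_X ^ 2)" "1 :: complex fps" k]
    by (simp add: fps_of_nat power_minus[of "fps_X ^ 2"] power_mult mult.assoc flip: fps_const_mult fps_const_power fps_const_neg)
  have "fps_nth ((1 - fps_X ^ 2) ^ k) (2 * j) = (\<Sum>i\<le>k. if i = j then of_nat (k choose i) * (- 1) ^ i else (0 :: complex))"
    unfolding eq fps_sum_nth by (intro sum.cong) (auto simp: fps_X_power_mult_right_nth)
  then show "fps_nth ((1 - fps_X ^ 2) ^ k) (2 * j) = ((- 1) ^ j * of_nat (k choose j) :: complex)"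
    by (simp add: mult.commute)
  show "odd m \<Longrightarrow> fps_nth ((1 - fps_X ^ 2) ^ k) m = (0 :: complex)"
    unfolding eq fps_sum_nth by (intro sum.neutral) (auto simp: fps_X_power_mult_right_nth)
qed

lemma bessel_coeff_eq:
  "bessel_coeff n (n + 2 * j) = (- 1) ^ j * of_nat ((n + 2 * j) choose j)"
  by (simp add: bessel_coeff_def fps_X_power_mult_right_nth fps_nth_one_minus_X_square_power)

lemma bessel_coeff_eq_0:
  assumes "k \<notin> range (\<lambda>j. n + 2 * j)"
  shows "bessel_coeff n k = 0"
proof (cases "k < n")
  case False
  then have "k = n + 2 * ((k - n) div 2)" if "even (k - n)" using that by simp
  then have "odd (k - n)" using assms by blast
  with False show ?thesis by (simp add: bessel_coeff_def fps_X_power_mult_right_nth fps_nth_one_minus_X_square_power)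
qed (simp add: bessel_coeff_def fps_X_power_mult_right_nth)

text \<open>The defining series is reindexed by the exponent \<open>k = n + 2 * j\<close>, where the
  binomial coefficient divided by \<open>fact k\<close> is
  \<open>1 / (fact j * fact (j + n))\<close>; at all other \<open>k\<close> the coefficient is
  zero.\<close>

lemma bessel_coeff_sums: "(\<lambda>k. bessel_coeff n k / fact k * (z / 2) ^ k) sums bessel_J n z"
proof -
  have "(\<lambda>j. bessel_coeff n (n + 2 * j) / fact (n + 2 * j) * (z / 2) ^ (n + 2 * j)) sums bessel_J n z"
  proof -
    have "bessel_coeff n (n + 2 * j) / fact (n + 2 * j) = (- 1) ^ j / (fact j * fact (j + n))" for j
    proof -
      have "of_nat ((n + 2 * j) choose j) = (fact (n + 2 * j) / (fact j * fact (j + n)) :: complex)"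
        by (subst binomial_fact) (simp_all add: add.commute)
      then show ?thesis unfolding bessel_coeff_eq by simp
    qed
    with summable_sums[OF summable_bessel_J[of n z]] show ?thesis
      by (simp add: bessel_J_def add.commute)
  qed
  then show ?thesis
    by (subst (asm) sums_mono_reindex[of "\<lambda>j. n + 2 * j" "\<lambda>k. bessel_coeff n k / fact k * (z / 2) ^ k"])
       (auto simp: strict_mono_def bessel_coeff_eq_0)
qed

text \<open>On the circle the integrand equals \<open>(1 - w ^ 2) ^ k * w ^ n / w ^ Suc k\<close>,
  so Cauchy's formula for the derivative of order \<open>k\<close> at 0 extracts the
  coefficient.\<close>

lemma has_contour_integral_bessel_coeff:
  "((\<lambda>w. (1 / w - w) ^ k * w ^ n / w) has_contour_integral 2 * of_real pi * \<i> * bessel_coeff n k) (circlepath 0 1)"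
proof -
  define p :: "complex \<Rightarrow> complex" where "p = (\<lambda>w. (1 - w ^ 2) ^ k * w ^ n)"
  have "p has_fps_expansion ((1 - fps_X ^ 2) ^ k * fps_X ^ n)"
    unfolding p_def by (intro fps_expansion_intros)
  then have "(deriv ^^ k) p 0 = fact k * bessel_coeff n k"
    using fps_nth_fps_expansion[of p _ k] by (simp add: bessel_coeff_def)
  moreover have "((\<lambda>u. p u / (u - 0) ^ Suc k) has_contour_integral (of_real (2 * pi) * \<i>) / fact k * (deriv ^^ k) p 0) (circlepath 0 1)"
    unfolding p_def
    by (rule Cauchy_has_contour_integral_higher_derivative_circlepath) (auto intro!: continuous_intros holomorphic_intros)
  ultimately have "((\<lambda>u. p u / u ^ Suc k) has_contour_integral 2 * of_real pi * \<i> * bessel_coeff n k) (circlepath 0 1)"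
    by (simp add: mult_ac)
  then show ?thesis
  proof (rule has_contour_integral_eq)
    fix w assume "w \<in> path_image (circlepath 0 1)"
    then have "w \<noteq> 0" by auto
    then have "(1 / w - w) * w = 1 - w ^ 2" by (simp add: field_simps power2_eq_square)
    then have "(1 / w - w) ^ k * w ^ k = (1 - w ^ 2) ^ k" by (simp flip: power_mult_distrib)
    with \<open>w \<noteq> 0\<close> show "p w / w ^ Suc k = (1 / w - w) ^ k * w ^ n / w"
      by (simp add: p_def field_simps)
  qed
qed

text \<open>The Weierstrass M-test makes the convergence uniform on the unit circle, so that sum and
  contour integral commute.\<close>

lemma contour_integral_circlepath_sums:
  fixes f :: "nat \<Rightarrow> complex \<Rightarrow> complex"
  assumes f: "\<And>k. (f k has_contour_integral I k) (circlepath 0 1)"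
    and le: "\<And>k w. norm w = 1 \<Longrightarrow> norm (f k w) \<le> M k" and M: "summable M"
    and g: "\<And>w. norm w = 1 \<Longrightarrow> (\<lambda>k. f k w) sums g w"
    and J: "(g has_contour_integral J) (circlepath 0 1)"
  shows "I sums J"
proof -
  have "uniform_limit (sphere 0 1) (\<lambda>N w. \<Sum>k<N. f k w) (\<lambda>w. \<Sum>k. f k w) sequentially"
    by (rule Weierstrass_m_test[OF _ M]) (simp add: le)
  also have "?this \<longleftrightarrow> uniform_limit (sphere 0 1) (\<lambda>N w. \<Sum>k<N. f k w) g sequentially"
    by (intro uniform_limit_cong) (use g in \<open>auto simp: sums_iff\<close>)
  finally have ul: "uniform_limit (sphere 0 1) (\<lambda>N w. \<Sum>k<N. f k w) g sequentially" .
  have int: "((\<lambda>w. \<Sum>k<N. f k w) has_contour_integral (\<Sum>k<N. I k)) (circlepath 0 1)" for N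
    by (intro has_contour_integral_sum f) auto
  have "(\<lambda>N. contour_integral (circlepath 0 1) (\<lambda>w. \<Sum>k<N. f k w)) \<longlonglongrightarrow> contour_integral (circlepath 0 1) g"
    by (rule contour_integral_uniform_limit_circlepath[OF _ ul])
       (use int in \<open>auto simp: contour_integrable_on_def intro!: always_eventually\<close>)
  then show ?thesis
    by (simp add: sums_def contour_integral_unique[OF int] contour_integral_unique[OF J])
qed

lemma norm_circle_diff_le:
  assumes "norm (w :: complex) = 1"
  shows "norm (1 / w - w) \<le> 2"
  using norm_triangle_ineq4[of "1 / w" w] assms by (simp add: norm_divide)

text \<open>The integrand above has modulus at most \<open>2 ^ k\<close> on a circle of length
  \<open>2 * pi\<close>. This is the growth bound that allows termwise integration of the Bessel
  series.\<close>

lemma norm_bessel_coeff_le: "norm (bessel_coeff n k) \<le> 2 ^ k"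
proof -
  have "norm (2 * of_real pi * \<i> * bessel_coeff n k) \<le> 2 ^ k * (2 * pi * 1)"
  proof (rule has_contour_integral_bound_circlepath[OF has_contour_integral_bessel_coeff])
    fix w :: complex assume "norm (w - 0) = 1"
    then show "norm ((1 / w - w) ^ k * w ^ n / w) \<le> 2 ^ k"
      using norm_circle_diff_le[of w] by (simp add: norm_mult norm_divide norm_power power_mono)
  qed auto
  then show ?thesis by (simp add: norm_mult)
qed

text \<open>Expanding the exponential and integrating termwise reproduces the series of
  \<open>bessel_coeff_sums\<close>.\<close>

lemma has_contour_integral_bessel_J:
  "((\<lambda>w. exp (z / 2 * (1 / w - w)) * w ^ n / w) has_contour_integral 2 * of_real pi * \<i> * bessel_J n z) (circlepath 0 1)"
proof -
  let ?g = "\<lambda>w. exp (z / 2 * (1 / w - w)) * w ^ n / w"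
  have "continuous_on (path_image (circlepath 0 1)) ?g"
    by (intro continuous_intros) auto
  then obtain J where J: "(?g has_contour_integral J) (circlepath 0 1)"
    using contour_integrable_continuous_circlepath contour_integrable_on_def by blast
  have "(\<lambda>k. (z / 2) ^ k / fact k * (2 * of_real pi * \<i> * bessel_coeff n k)) sums J"
  proof (rule contour_integral_circlepath_sums[OF has_contour_integral_lmul[OF has_contour_integral_bessel_coeff] _ _ _ J])
    fix k and w :: complex assume w: "norm w = 1"
    have "norm ((z / 2) ^ k / fact k * ((1 / w - w) ^ k * w ^ n / w)) = (norm z / 2) ^ k / fact k * norm (1 / w - w) ^ k"
      using w by (simp add: norm_mult norm_divide norm_power)
    also have "\<dots> \<le> (norm z / 2) ^ k / fact k * 2 ^ k"
      using norm_circle_diff_le[OF w] by (intro mult_left_mono power_mono) auto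
    also have "\<dots> = inverse (fact k) * norm z ^ k" by (simp add: field_simps)
    finally show "norm ((z / 2) ^ k / fact k * ((1 / w - w) ^ k * w ^ n / w)) \<le> inverse (fact k) * norm z ^ k" .
  next
    show "summable (\<lambda>k. inverse (fact k) * norm z ^ k)" by (rule summable_exp)
  next
    fix w :: complex assume w: "norm w = 1"
    have "(\<lambda>k. (z / 2 * (1 / w - w)) ^ k / fact k * (w ^ n / w)) sums (exp (z / 2 * (1 / w - w)) * (w ^ n / w))"
      by (intro sums_mult2) (use exp_converges[of "z / 2 * (1 / w - w)"] in \<open>simp add: scaleR_conv_of_real field_simps\<close>)
    moreover have "(z / 2 * (1 / w - w)) ^ k / fact k * (w ^ n / w) = (z / 2) ^ k / fact k * ((1 / w - w) ^ k * w ^ n / w)" for k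
      unfolding power_mult_distrib[of "z / 2"] by simp
    ultimately show "(\<lambda>k. (z / 2) ^ k / fact k * ((1 / w - w) ^ k * w ^ n / w)) sums ?g w"
      by (simp only: times_divide_eq_right)
  qed
  moreover have "(\<lambda>k. 2 * of_real pi * \<i> * (bessel_coeff n k / fact k * (z / 2) ^ k)) sums (2 * of_real pi * \<i> * bessel_J n z)"
    by (intro sums_mult bessel_coeff_sums)
  ultimately have "J = 2 * of_real pi * \<i> * bessel_J n z"
    by (intro sums_unique2[of _ J]) (simp_all add: mult_ac)
  with J show ?thesis by simp
qed

text \<open>On the unit circle \<open>1 / w - w = cnj w - w\<close> is purely imaginary, so for real
  \<open>x\<close> the integrand of the contour integral has modulus 1.\<close>

lemma norm_bessel_J_le_1: "norm (bessel_J n (of_real x)) \<le> 1"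
proof -
  have "norm (2 * of_real pi * \<i> * bessel_J n (of_real x)) \<le> 1 * (2 * pi * 1)"
  proof (rule has_contour_integral_bound_circlepath[OF has_contour_integral_bessel_J])
    fix w :: complex assume "norm (w - 0) = 1"
    then have w: "norm w = 1" by simp
    define v where "v = 1 / w - w"
    have "Re v = 0" using w by (simp add: v_def divide_conv_cnj)
    moreover have "of_real x / 2 * v = of_real (x / 2) * v" by simp
    ultimately have "Re (of_real x / 2 * v) = 0"
      by (metis Re_complex_of_real Im_complex_of_real times_complex.sel(1) mult_zero_left mult_zero_right diff_zero)
    then have "norm (exp (of_real x / 2 * v)) = 1" by (simp only: norm_exp_eq_Re exp_zero)
    then have "norm (exp (of_real x / 2 * v) * w ^ n / w) = 1"
      by (simp only: norm_mult norm_divide norm_power w power_one div_by_1 mult_1)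
    then show "norm (exp (of_real x / 2 * (1 / w - w)) * w ^ n / w) \<le> 1"
      unfolding v_def by (rule eq_refl)
  qed auto
  then show ?thesis by (simp add: norm_mult)
qed

lemma bessel_J_holomorphic: "bessel_J n holomorphic_on UNIV"
proof -
  have "bessel_J n holomorphic_on ball 0 r" for r
  proof (rule power_series_holomorphic)
    fix w show "(\<lambda>k. bessel_coeff n k / fact k / 2 ^ k * (w - 0) ^ k) sums bessel_J n w"
      using bessel_coeff_sums[of n w] by (simp add: power_divide)
  qed
  then have "bessel_J n analytic_on ball 0 r" for r
    by (simp add: analytic_on_open)
  then have "bessel_J n analytic_on {z}" for z
    by (rule analytic_on_subset[of _ "ball 0 (norm z + 1)"]) auto
  then show ?thesis
    by (metis analytic_imp_holomorphic analytic_on_analytic_at)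
qed

text \<open>Under the contour integral the series becomes geometric, convergent because
  \<open>lam / 2 * norm (1 / w - w) \<le> lam < s\<close>. Its sum is a rational function of
  \<open>w\<close> with a single pole inside the circle, where Cauchy's formula gives the
  value.\<close>

lemma bessel_laplace_series_sums:
  fixes s lam :: real
  assumes lam: "0 < lam" "lam < s"
  defines "q \<equiv> sqrt (s\<^sup>2 + lam\<^sup>2)"
  shows "(\<lambda>k. bessel_coeff n k * of_real (lam / 2) ^ k / of_real s ^ Suc k) sums
           of_real ((q - s) ^ n / (lam ^ n * q))"
proof -
  \<comment> \<open>\<open>w0\<close> and \<open>w1\<close> are the roots of
    \<open>lam / 2 * w ^ 2 + s * w - lam / 2\<close>. Their product is -1, and \<open>w0\<close> is
    the one inside the unit circle.\<close>
  define w0 where "w0 = (q - s) / lam"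
  define w1 where "w1 = - (q + s) / lam"
  have q2: "q * q = s * s + lam * lam"
    by (simp add: q_def power2_eq_square)
  have q: "s < q" "q > 0" using lam by (auto simp: q_def real_less_rsqrt intro!: sum_power2_gt_zero_iff[THEN iffD2])
  have "q < s + lam"
    using lam unfolding q_def by (intro real_less_lsqrt) (auto simp: power2_eq_square algebra_simps)
  with q lam have w0: "\<bar>w0\<bar> < 1" by (auto simp: w0_def)
  have w1: "\<bar>w1\<bar> > 1" using q lam by (auto simp: w1_def)
  define f :: "complex \<Rightarrow> complex" where "f = (\<lambda>w. w ^ n / (of_real (lam / 2) * (w - of_real w1)))"
  have "f holomorphic_on cball 0 1"
    unfolding f_def by (intro holomorphic_intros) (use lam w1 in auto)
  then have "((\<lambda>w. f w / (w - of_real w0)) has_contour_integral 2 * of_real pi * \<i> * f (of_real w0)) (circlepath 0 1)"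
    using w0 by (intro Cauchy_integral_circlepath_simple) auto
  then have int: "((\<lambda>w. 1 / (of_real s - of_real (lam / 2) * (1 / w - w)) * (w ^ n / w)) has_contour_integral 2 * of_real pi * \<i> * f (of_real w0)) (circlepath 0 1)"
  proof (rule has_contour_integral_eq)
    fix w :: complex assume "w \<in> path_image (circlepath 0 1)"
    then have w: "norm w = 1" "w \<noteq> 0" by auto
    have sum: "lam * (w0 + w1) = - (2 * s)" using lam by (simp add: w0_def w1_def field_simps)
    have "w0 * w1 = - ((q * q - s * s) / (lam * lam))"
      by (simp add: w0_def w1_def algebra_simps minus_divide_left)
    then have prod: "w0 * w1 = - 1" using lam unfolding q2 by simp
    from arg_cong[OF sum, of complex_of_real] arg_cong[OF prod, of complex_of_real]
    have v: "of_real lam * (of_real w0 + of_real w1) = - (2 * complex_of_real s)" "of_real w0 * of_real w1 = (- 1 :: complex)"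
      by simp_all
    have "of_real (lam / 2) * (w - of_real w1) * (w - of_real w0) =
        of_real lam / 2 * w ^ 2 - of_real lam * (of_real w0 + of_real w1) / 2 * w + of_real lam / 2 * (of_real w0 * of_real w1)"
      by (simp add: field_simps power2_eq_square)
    also have "\<dots> = (of_real s - of_real (lam / 2) * (1 / w - w)) * w"
      unfolding v using w by (simp add: field_simps power2_eq_square)
    finally have "of_real (lam / 2) * (w - of_real w1) * (w - of_real w0) = (of_real s - of_real (lam / 2) * (1 / w - w)) * w" .
    then show "f w / (w - of_real w0) = 1 / (of_real s - of_real (lam / 2) * (1 / w - w)) * (w ^ n / w)"
      by (simp add: f_def)
  qed
  have "(\<lambda>k. of_real (lam / 2) ^ k / of_real s ^ Suc k * (2 * of_real pi * \<i> * bessel_coeff n k)) sums (2 * of_real pi * \<i> * f (of_real w0))"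
  proof (rule contour_integral_circlepath_sums[OF has_contour_integral_lmul[OF has_contour_integral_bessel_coeff] _ _ _ int])
    fix k and w :: complex assume w: "norm w = 1"
    have "norm (of_real (lam / 2) ^ k / of_real s ^ Suc k * ((1 / w - w) ^ k * w ^ n / w)) = (lam / 2) ^ k / s ^ Suc k * norm (1 / w - w) ^ k"
      using w lam by (simp add: norm_mult norm_divide norm_power)
    also have "\<dots> \<le> (lam / 2) ^ k / s ^ Suc k * 2 ^ k"
      using norm_circle_diff_le[OF w] lam by (intro mult_left_mono power_mono) auto
    also have "\<dots> = (lam / s) ^ k / s" by (simp add: field_simps)
    finally show "norm (of_real (lam / 2) ^ k / of_real s ^ Suc k * ((1 / w - w) ^ k * w ^ n / w)) \<le> (lam / s) ^ k / s" .
  next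
    show "summable (\<lambda>k. (lam / s) ^ k / s)"
      using lam by (intro summable_divide summable_geometric) auto
  next
    fix w :: complex assume w: "norm w = 1"
    define u where "u = of_real (lam / 2) * (1 / w - w) / of_real s"
    have "norm u = (lam / 2) / s * norm (1 / w - w)"
      using lam by (simp add: u_def norm_mult norm_divide)
    also have "\<dots> \<le> (lam / 2) / s * 2"
      using norm_circle_diff_le[OF w] lam by (intro mult_left_mono) auto
    also have "\<dots> < 1" using lam by simp
    finally have "(\<lambda>k. u ^ k / of_real s * (w ^ n / w)) sums (1 / (1 - u) / of_real s * (w ^ n / w))"
      by (intro sums_mult2 sums_divide geometric_sums)
    moreover have "1 / (1 - u) / of_real s = 1 / (of_real s - of_real (lam / 2) * (1 / w - w))"
    proof -
      have "(1 - u) * of_real s = of_real s - of_real (lam / 2) * (1 / w - w)"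
        using lam by (simp add: u_def left_diff_distrib)
      then show ?thesis by simp
    qed
    moreover have "u ^ k / of_real s * (w ^ n / w) = of_real (lam / 2) ^ k / of_real s ^ Suc k * ((1 / w - w) ^ k * w ^ n / w)" for k
      by (simp add: u_def power_mult_distrib power_divide mult_ac)
    ultimately show "(\<lambda>k. of_real (lam / 2) ^ k / of_real s ^ Suc k * ((1 / w - w) ^ k * w ^ n / w)) sums
        (1 / (of_real s - of_real (lam / 2) * (1 / w - w)) * (w ^ n / w))"
      by simp
  qed
  from sums_mult[OF this, of "1 / (2 * of_real pi * \<i>)"]
  have "(\<lambda>k. bessel_coeff n k * of_real (lam / 2) ^ k / of_real s ^ Suc k) sums f (of_real w0)"
    by (simp add: mult_ac)
  moreover have "w0 ^ n / (lam / 2 * (w0 - w1)) = (q - s) ^ n / (lam ^ n * q)"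
  proof -
    have "lam / 2 * (w0 - w1) = q" using lam by (simp add: w0_def w1_def field_simps)
    then show ?thesis by (simp add: w0_def power_divide)
  qed
  then have "f (of_real w0) = of_real ((q - s) ^ n / (lam ^ n * q))"
    unfolding f_def by (simp flip: of_real_power of_real_diff of_real_mult of_real_divide)
  ultimately show ?thesis by simp
qed

lemma absolutely_integrable_exp_minus:
  assumes "0 < s"
  shows "(\<lambda>x. complex_of_real (exp (- s * x))) absolutely_integrable_on {0..}"
  unfolding absolutely_integrable_on_def
proof
  have int: "(\<lambda>x. exp (- s * x)) integrable_on {0..}"
    using integrable_on_exp_minus_to_infinity[OF assms] by simp
  then show "(\<lambda>x. complex_of_real (exp (- s * x))) integrable_on {0..}"
    using has_integral_of_real by (metis has_integral_integrable integrable_integral)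
  show "(\<lambda>x. norm (complex_of_real (exp (- s * x)))) integrable_on {0..}"
    using int by (simp del: of_real_exp)
qed

subsection \<open>The Laplace transform of a Bessel function\<close>

definition bessel_laplace :: "nat \<Rightarrow> real \<Rightarrow> complex \<Rightarrow> complex" where
  "bessel_laplace n lam s =
     (csqrt (s ^ 2 + of_real lam ^ 2) - s) ^ n / (of_real lam ^ n * csqrt (s ^ 2 + of_real lam ^ 2))"

lemma open_strip: "open {s. \<bar>Im s\<bar> < a}"
  by (intro open_Collect_less continuous_intros)

text \<open>Keeps the argument of \<open>csqrt\<close> off the branch cut and away from 0, which
  gives both holomorphy of the root and a nonzero denominator on the strip. The real part alone
  yields the contradiction.\<close>

lemma square_add_square_notin_nonpos_Reals:
  assumes "\<bar>Im s\<bar> < lam"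
  shows "s ^ 2 + of_real lam ^ 2 \<notin> \<real>\<^sub>\<le>\<^sub>0"
proof
  assume "s ^ 2 + of_real lam ^ 2 \<in> \<real>\<^sub>\<le>\<^sub>0"
  then have re: "(Re s)\<^sup>2 - (Im s)\<^sup>2 + lam\<^sup>2 \<le> 0" and im: "Re s * Im s = 0"
    by (auto simp: complex_nonpos_Reals_iff Re_power2 Im_power2 simp flip: of_real_power)
  have "(Im s)\<^sup>2 < lam\<^sup>2" using power_strict_mono[OF assms, of 2] by simp
  with re show False using zero_le_power2[of "Re s"] by linarith
qed

lemma bessel_laplace_holomorphic:
  assumes "0 < lam"
  shows "bessel_laplace n lam holomorphic_on {s. \<bar>Im s\<bar> < lam}"
proof -
  note notin = square_add_square_notin_nonpos_Reals
  have "(\<lambda>s. csqrt (s ^ 2 + of_real lam ^ 2)) holomorphic_on {s. \<bar>Im s\<bar> < lam}"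
    by (intro holomorphic_on_csqrt' holomorphic_intros notin) simp
  moreover have "csqrt (s ^ 2 + of_real lam ^ 2) \<noteq> 0" if "\<bar>Im s\<bar> < lam" for s
    using notin[OF that] by auto
  ultimately show ?thesis using assms
    unfolding bessel_laplace_def by (intro holomorphic_intros) (auto dest: notin)
qed

lemma bessel_laplace_of_real:
  assumes "0 < lam"
  shows "bessel_laplace n lam (of_real s) =
    of_real ((sqrt (s\<^sup>2 + lam\<^sup>2) - s) ^ n / (lam ^ n * sqrt (s\<^sup>2 + lam\<^sup>2)))"
proof -
  have "csqrt ((of_real s)\<^sup>2 + (of_real lam)\<^sup>2) = of_real (sqrt (s\<^sup>2 + lam\<^sup>2))"
    by (simp flip: of_real_power of_real_add)
  then show ?thesis by (simp add: bessel_laplace_def)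
qed

lemma continuous_on_bessel_J: "continuous_on A (\<lambda>x::real. bessel_J n (of_real (lam * x)))"
proof -
  have "continuous_on UNIV (bessel_J n)"
    by (rule holomorphic_on_imp_continuous_on[OF bessel_J_holomorphic])
  then show ?thesis
    by (rule continuous_on_compose2) (auto intro!: continuous_intros)
qed

text \<open>Termwise integration: the moment \<open>fact k / s ^ Suc k\<close> cancels the factorial
  in the Bessel series and leaves the series summed in
  \<open>bessel_laplace_series_sums\<close>.\<close>

lemma integral_exp_bessel_J:
  assumes lam: "0 < lam" "lam < s"
  shows "integral {0..} (\<lambda>x. exp (- of_real s * of_real x) * bessel_J n (of_real (lam * x))) =
           bessel_laplace n lam (of_real s)"
proof -
  define c where "c = (\<lambda>k. bessel_coeff n k / fact k * of_real (lam / 2) ^ k)"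
  have c: "norm (c k) * fact k \<le> 1 * lam ^ k" for k
    using norm_bessel_coeff_le[of n k] lam
    by (simp add: c_def norm_mult norm_divide norm_power power_divide field_simps)
  have int: "(\<lambda>x. of_real (exp (lam * x)) * complex_of_real (exp (- s * x))) absolutely_integrable_on {0..}"
    using absolutely_integrable_exp_minus[of "s - lam"] lam
    by (simp add: algebra_simps flip: of_real_mult exp_add)
  have mom: "integral {0..} (\<lambda>x. complex_of_real x ^ k * of_real (exp (- s * x))) = of_real (fact k / s ^ Suc k)" for k
  proof -
    have "((\<lambda>x. complex_of_real (x ^ k * exp (- s * x))) has_integral of_real (fact k / s ^ Suc k)) {0..}"
      by (intro has_integral_of_real has_integral_power_times_exp) (use lam in auto)
    then show ?thesis by (intro integral_unique) simp
  qed
  have eq: "(\<Sum>k. c k * of_real x ^ k) = bessel_J n (of_real (lam * x))" for x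
    using bessel_coeff_sums[of n "of_real (lam * x)"]
    by (simp add: c_def sums_iff power_mult_distrib power_divide mult_ac)
  have "(\<lambda>k. c k * of_real (fact k / s ^ Suc k)) sums
      integral {0..} (\<lambda>x. bessel_J n (of_real (lam * x)) * of_real (exp (- s * x)))"
    using sums_integral_moments(2)[OF int lam(1) c] unfolding mom eq .
  moreover have "c k * of_real (fact k / s ^ Suc k) = bessel_coeff n k * of_real (lam / 2) ^ k / of_real s ^ Suc k" for k
    by (simp add: c_def)
  ultimately have "integral {0..} (\<lambda>x. bessel_J n (of_real (lam * x)) * of_real (exp (- s * x))) = bessel_laplace n lam (of_real s)"
    using bessel_laplace_series_sums[OF lam, of n] unfolding bessel_laplace_of_real[OF lam(1)]
    by (metis (no_types, lifting) sums_cong sums_unique2)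
  moreover have "exp (- of_real s * of_real x) * bessel_J n (of_real (lam * x)) =
      bessel_J n (of_real (lam * x)) * of_real (exp (- s * x))" for x
    unfolding exp_of_real[symmetric] by simp
  ultimately show ?thesis by (simp only:)
qed

text \<open>The identity theorem: every point of the ray, here \<open>a + 1\<close>, is a limit
  point of it, and a convex set is connected.\<close>

lemma holomorphic_eq_of_eq_on_half_line:
  assumes f: "f holomorphic_on S" and g: "g holomorphic_on S" and S: "open S" "convex S"
    and sub: "of_real ` {a<..} \<subseteq> S" and eq: "\<And>u::real. a < u \<Longrightarrow> f (of_real u) = g (of_real u)"
    and z: "z \<in> S"
  shows "f z = (g z :: complex)"
proof -
  have "complex_of_real (a + 1) islimpt of_real ` {a<..}"
    unfolding islimpt_approachable
  proof (intro allI impI)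
    fix e :: real assume "0 < e"
    then have "complex_of_real (a + 1 + e / 2) \<in> of_real ` {a<..}" by (intro imageI) auto
    with \<open>0 < e\<close> show "\<exists>x'\<in>of_real ` {a<..}. x' \<noteq> complex_of_real (a + 1) \<and> dist x' (of_real (a + 1)) < e"
      by (intro bexI[of _ "of_real (a + 1 + e / 2)"]) (auto simp: dist_norm norm_divide)
  qed
  moreover have "complex_of_real (a + 1) \<in> S"
    by (rule subsetD[OF sub], rule imageI) simp
  moreover have "(\<lambda>z. f z - g z) holomorphic_on S" by (intro holomorphic_intros f g)
  ultimately have "f z - g z = 0"
    using analytic_continuation[of "\<lambda>z. f z - g z" S "of_real ` {a<..}" "of_real (a + 1)" z]
      S z sub eq by (auto simp: convex_connected)
  then show ?thesis by simp
qed

text \<open>The closed form is so far known for real \<open>s\<close> only. The identity theorem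
  extends it to a complex neighbourhood, after which \<open>higher_deriv_laplace\<close> turns
  derivatives into moments.\<close>

lemma moment_bessel_J:
  assumes lam: "0 < lam" "lam < s"
  shows "integral {0..} (\<lambda>x. of_real x ^ k * (exp (- of_real s * of_real x) * bessel_J n (of_real (lam * x)))) =
           (- 1) ^ k * (deriv ^^ k) (bessel_laplace n lam) (of_real s)"
proof -
  \<comment> \<open>The bound on the Bessel function gives no integrability by itself. The factor
    \<open>exp (- lam * x)\<close> supplies it, at the price of shifting the Laplace variable by
    \<open>lam\<close>.\<close>
  define f where "f = (\<lambda>x. bessel_J n (of_real (lam * x)) * of_real (exp (- lam * x)))"
  have f: "f absolutely_integrable_on {0..}" unfolding f_def
    by (rule absolutely_integrable_bounded_continuous_mult[OF absolutely_integrable_exp_minus[OF lam(1)] continuous_on_bessel_J])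
       (rule norm_bessel_J_le_1)
  have exp_f: "exp (- z * of_real x) * f x = exp (- (z + of_real lam) * of_real x) * bessel_J n (of_real (lam * x))" for z x
  proof -
    have "complex_of_real (exp (- lam * x)) = exp (- of_real lam * of_real x)"
      unfolding exp_of_real[symmetric] by simp
    moreover have "exp (- (z + of_real lam) * of_real x) = exp (- z * of_real x) * exp (- of_real lam * of_real x)"
      unfolding mult_exp_exp by (simp add: algebra_simps)
    ultimately show ?thesis by (simp add: f_def)
  qed
  define S where "S = {z. 0 < Re z} \<inter> ({z. - lam < Im z} \<inter> {z. Im z < lam})"
  have S: "open S" "convex S"
    unfolding S_def
    by (intro open_Int open_halfspace_Re_gt open_halfspace_Im_gt open_halfspace_Im_lt)
       (intro convex_Int convex_halfspace_Re_gt convex_halfspace_Im_gt convex_halfspace_Im_lt)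
  have eq: "laplace f z = bessel_laplace n lam (z + of_real lam)" if "z \<in> S" for z
  proof (rule holomorphic_eq_of_eq_on_half_line[OF _ _ S _ _ that, of _ _ 0])
    show "laplace f holomorphic_on S"
      by (rule holomorphic_on_subset[OF laplace_holomorphic[OF f]]) (auto simp: S_def)
    have "bessel_laplace n lam \<circ> (\<lambda>z. z + of_real lam) holomorphic_on S"
      by (rule holomorphic_on_compose_gen[OF _ bessel_laplace_holomorphic[OF lam(1)]])
         (auto simp: S_def intro!: holomorphic_intros)
    then show "(\<lambda>z. bessel_laplace n lam (z + of_real lam)) holomorphic_on S" by (simp add: o_def)
    show "of_real ` {0<..} \<subseteq> S" using lam by (auto simp: S_def)
    show "laplace f (of_real u) = bessel_laplace n lam (of_real u + of_real lam)" if "0 < u" for u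
      using integral_exp_bessel_J[of lam "u + lam" n] that lam unfolding laplace_def exp_f by simp
  qed
  define t where "t = complex_of_real (s - lam)"
  have t: "t \<in> S" "0 < Re t" using lam by (auto simp: t_def S_def)
  have "(deriv ^^ k) (laplace f) t = (deriv ^^ k) (\<lambda>z. bessel_laplace n lam (z + of_real lam)) t"
    using S(1) t(1) eq by (intro higher_deriv_cong_ev refl) (auto simp: eventually_nhds)
  also have "\<dots> = (deriv ^^ k) (bessel_laplace n lam) (of_real s)"
    by (subst (1 2) higher_deriv_shift_0) (simp add: t_def o_def add.commute add.left_commute)
  finally have deriv_eq: "(deriv ^^ k) (laplace f) t = (deriv ^^ k) (bessel_laplace n lam) (of_real s)" .
  have ts: "t + of_real lam = of_real s" by (simp add: t_def)
  have sgn: "(- 1) ^ k * (- 1) ^ k = (1 :: complex)" by (simp flip: power_mult_distrib)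
  show ?thesis
    using higher_deriv_laplace[OF f t(2), of k] unfolding exp_f ts deriv_eq
    by (simp only: mult.assoc[symmetric] sgn mult_1)
qed

section \<open>The differential equation and the Taylor coefficients at the origin\<close>

lemma bessel_laplace_ode:
  fixes n :: nat
  assumes lam: "0 < lam" and s: "\<bar>Im s\<bar> < lam"
  defines "L \<equiv> bessel_laplace n lam"
  shows "(s ^ 2 + of_real lam ^ 2) * deriv (deriv L) s + 3 * s * deriv L s + (1 - of_nat n ^ 2) * L s = 0"
proof -
  define q where "q = (\<lambda>z. csqrt (z ^ 2 + of_real lam ^ 2))"
  have q2: "q z ^ 2 = z ^ 2 + of_real lam ^ 2" for z by (simp add: q_def)
  have q: "(q has_field_derivative z / q z) (at z)" and q0: "q z \<noteq> 0" if "\<bar>Im z\<bar> < lam" for z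
  proof -
    show "q z \<noteq> 0" using square_add_square_notin_nonpos_Reals[OF that] by (auto simp: q_def)
    show "(q has_field_derivative z / q z) (at z)"
      unfolding q_def
      by (rule derivative_eq_intros refl square_add_square_notin_nonpos_Reals[OF that])+ simp
  qed
  have L: "L = (\<lambda>z. (q z - z) ^ n / (of_real lam ^ n * q z))"
    by (auto simp: L_def q_def bessel_laplace_def)
  \<comment> \<open>Logarithmic differentiation with \<open>q' = z / q\<close>: the power of
    \<open>q z - z\<close> contributes \<open>- n / q\<close> and the denominator
    \<open>- z / q ^ 2\<close>.\<close>
  define D where "D = (\<lambda>z. - (of_nat n / q z + z / q z ^ 2) * L z)"
  have dL: "(L has_field_derivative D z) (at z)" if z: "\<bar>Im z\<bar> < lam" for z
  proof -
    have eq: "of_nat n * ((z / q z - 1) * (q z - z) ^ (n - Suc 0)) = - of_nat n / q z * (q z - z) ^ n"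
      using q0[OF z] by (cases n) (auto simp: field_simps)
    have "((\<lambda>z. q z - z) has_field_derivative z / q z - 1) (at z)"
      by (intro DERIV_diff q[OF z] DERIV_ident)
    from DERIV_power[OF this, of n]
    have P: "((\<lambda>z. (q z - z) ^ n) has_field_derivative - of_nat n / q z * (q z - z) ^ n) (at z)"
      unfolding eq .
    have Q: "((\<lambda>z. of_real lam ^ n * q z) has_field_derivative of_real lam ^ n * (z / q z)) (at z)"
      by (intro DERIV_cmult q[OF z])
    have nz: "of_real lam ^ n * q z \<noteq> 0" using lam q0[OF z] by simp
    have "(- of_nat n / q z * (q z - z) ^ n * (of_real lam ^ n * q z) - (q z - z) ^ n * (of_real lam ^ n * (z / q z)))
        / ((of_real lam ^ n * q z) * (of_real lam ^ n * q z)) = D z"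
      using lam q0[OF z] unfolding D_def L by (simp add: divide_simps) (simp add: algebra_simps power2_eq_square)
    then show ?thesis using DERIV_divide[OF P Q nz] unfolding L by simp
  qed
  have dD: "(D has_field_derivative
      ((of_nat n * z / q z ^ 3 - 1 / q z ^ 2 + 2 * z ^ 2 / q z ^ 4) * L z - (of_nat n / q z + z / q z ^ 2) * D z)) (at z)"
    if z: "\<bar>Im z\<bar> < lam" for z
    unfolding D_def
    by (rule derivative_eq_intros q[OF z] dL[OF z] refl | (simp add: q0[OF z]; fail))+
       (use q0[OF z] in \<open>simp add: D_def field_simps power2_eq_square power3_eq_cube power4_eq_xxxx\<close>)
  have dL': "deriv L z = D z" if "\<bar>Im z\<bar> < lam" for z by (rule DERIV_imp_deriv[OF dL[OF that]])
  \<comment> \<open>A second differentiation needs \<open>deriv L = D\<close> on a neighbourhood of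
    \<open>s\<close>, not just at \<open>s\<close>.\<close>
  have "eventually (\<lambda>z. z \<in> {z. \<bar>Im z\<bar> < lam}) (nhds s)"
    by (rule eventually_nhds_in_open[OF open_strip]) (use s in simp)
  then have "deriv (deriv L) s = deriv D s"
    by (intro deriv_cong_ev refl) (auto elim!: eventually_mono simp: dL')
  then have ddL: "deriv (deriv L) s = (of_nat n * s / q s ^ 3 - 1 / q s ^ 2 + 2 * s ^ 2 / q s ^ 4) * L s - (of_nat n / q s + s / q s ^ 2) * D s"
    using DERIV_imp_deriv[OF dD[OF s]] by simp
  have "q s ^ 2 * deriv (deriv L) s + 3 * s * D s + (1 - of_nat n ^ 2) * L s = 0"
    using q0[OF s] unfolding ddL unfolding D_def
    by (simp add: field_simps power2_eq_square power3_eq_cube power4_eq_xxxx)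
  then show ?thesis unfolding q2 dL'[OF s] .
qed

text \<open>Comparing coefficients of order \<open>k\<close> in the differential equation, where
  \<open>k * (k - 1) + 3 * k + 1 - n ^ 2 = (k + 1) ^ 2 - n ^ 2\<close>.\<close>

lemma bessel_laplace_fps:
  assumes lam: "0 < lam"
  obtains F where "bessel_laplace n lam has_fps_expansion F"
    "\<And>k. of_real lam ^ 2 * of_nat ((k + 1) * (k + 2)) * fps_nth F (k + 2) = (of_nat n ^ 2 - of_nat (k + 1) ^ 2) * fps_nth F k"
proof
  let ?L = "bessel_laplace n lam"
  define F where "F = fps_expansion ?L 0"
  show F: "?L has_fps_expansion F"
    unfolding F_def
    by (rule has_fps_expansion_fps_expansion[OF open_strip _ bessel_laplace_holomorphic[OF lam]]) (use lam in simp)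
  define G where "G = (fps_X ^ 2 + fps_const (of_real lam ^ 2)) * fps_deriv (fps_deriv F) + fps_const 3 * fps_X * fps_deriv F
      + fps_const (1 - of_nat n ^ 2) * F"
  have "(\<lambda>s. (s ^ 2 + of_real lam ^ 2) * deriv (deriv ?L) s + 3 * s * deriv ?L s + (1 - of_nat n ^ 2) * ?L s) has_fps_expansion G"
    unfolding G_def by (intro fps_expansion_intros F) 
  moreover have "(\<lambda>s. (s ^ 2 + of_real lam ^ 2) * deriv (deriv ?L) s + 3 * s * deriv ?L s + (1 - of_nat n ^ 2) * ?L s) has_fps_expansion 0"
    unfolding has_fps_expansion_0_iff
  proof -
    have "eventually (\<lambda>z. z \<in> {z. \<bar>Im z\<bar> < lam}) (nhds 0)"
      by (rule eventually_nhds_in_open[OF open_strip]) (use lam in simp)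
    then show "eventually (\<lambda>s. (s ^ 2 + of_real lam ^ 2) * deriv (deriv ?L) s + 3 * s * deriv ?L s + (1 - of_nat n ^ 2) * ?L s = 0) (nhds 0)"
      by (rule eventually_mono) (use bessel_laplace_ode[OF lam] in simp)
  qed
  ultimately have "G = 0" by (rule fps_expansion_unique_complex)
  then have G0: "fps_nth G k = 0" for k by simp
  show "of_real lam ^ 2 * of_nat ((k + 1) * (k + 2)) * fps_nth F (k + 2) = (of_nat n ^ 2 - of_nat (k + 1) ^ 2) * fps_nth F k" for k
  proof -
    have "fps_nth (fps_X ^ 2 * fps_deriv (fps_deriv F)) k = of_nat k * (of_nat k - 1) * fps_nth F k"
      by (cases k rule: nat.exhaust; cases "k - 1") (auto simp: fps_X_power_mult_nth numeral_2_eq_2 algebra_simps)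
    moreover have "fps_nth (fps_const 3 * fps_X * fps_deriv F) k = 3 * of_nat k * fps_nth F k"
      by (cases k) (simp_all add: mult.assoc)
    moreover have "fps_nth (fps_const (of_real lam ^ 2) * fps_deriv (fps_deriv F)) k =
        of_real lam ^ 2 * of_nat ((k + 1) * (k + 2)) * fps_nth F (k + 2)"
      by (simp add: algebra_simps)
    moreover have "fps_nth (fps_const (1 - of_nat n ^ 2) * F) k = (1 - of_nat n ^ 2) * fps_nth F k"
      by simp
    ultimately have "of_nat k * (of_nat k - 1) * fps_nth F k
        + of_real lam ^ 2 * of_nat ((k + 1) * (k + 2)) * fps_nth F (k + 2)
        + 3 * of_nat k * fps_nth F k + (1 - of_nat n ^ 2) * fps_nth F k = 0"
      using G0[of k] unfolding G_def distrib_right fps_add_nth by (simp only:)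
    note * = this
    have "of_real lam ^ 2 * of_nat ((k + 1) * (k + 2)) * fps_nth F (k + 2) =
        - (of_nat k * (of_nat k - 1) * fps_nth F k + 3 * of_nat k * fps_nth F k + (1 - of_nat n ^ 2) * fps_nth F k)"
    proof -
      have "x = - (u + v + w)" if "u + x + v + w = 0" for u v w x :: complex
        using that by algebra
      from this[OF *] show ?thesis .
    qed
    then show ?thesis by (simp add: algebra_simps power2_eq_square)
  qed
qed

text \<open>At even orders the factor of the recursion is \<open>4 * (l - j) * (l + j + 1)\<close>.
  It builds up the factorial quotient from the value \<open>1 / lam\<close> at \<open>j = 0\<close>
  and vanishes at \<open>j = l\<close>, which cuts the sequence off.\<close>

lemma higher_deriv_bessel_laplace_0:
  assumes lam: "0 < lam"
  shows "(deriv ^^ (2 * j)) (bessel_laplace (2 * l + 1) lam) 0 =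
    (if j \<le> l then of_real (1 / 2 * (fact (l + j) / fact (l - j)) * (2 / lam) ^ (2 * j + 1)) else 0)"
proof -
  obtain F where F: "bessel_laplace (2 * l + 1) lam has_fps_expansion F"
    and rec: "\<And>k. of_real lam ^ 2 * of_nat ((k + 1) * (k + 2)) * fps_nth F (k + 2) = (of_nat (2 * l + 1) ^ 2 - of_nat (k + 1) ^ 2) * fps_nth F k"
    using bessel_laplace_fps[OF lam] by blast
  have deriv_eq: "(deriv ^^ k) (bessel_laplace (2 * l + 1) lam) 0 = fact k * fps_nth F k" for k
    using fps_nth_fps_expansion[OF F, of k] by simp
  show ?thesis
  proof (induction j)
    case 0
    show ?case using lam bessel_laplace_of_real[OF lam, of "2 * l + 1" 0] by simp
  next
    case (Suc j)
    let ?d = "\<lambda>k. (deriv ^^ k) (bessel_laplace (2 * l + 1) lam) 0"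
    have "of_real lam ^ 2 * ?d (2 * Suc j) = fact (2 * j) * (of_real lam ^ 2 * of_nat ((2 * j + 1) * (2 * j + 2)) * fps_nth F (2 * j + 2))"
      unfolding deriv_eq by (simp add: algebra_simps)
    also have "\<dots> = (of_nat (2 * l + 1) ^ 2 - of_nat (2 * j + 1) ^ 2) * ?d (2 * j)"
      unfolding rec deriv_eq by simp
    also have "\<dots> = of_real (4 * (real l - real j) * (real l + real j + 1)) * ?d (2 * j)"
      by (simp add: power2_eq_square algebra_simps)
    finally have step: "?d (2 * Suc j) = of_real (4 * (real l - real j) * (real l + real j + 1) / lam ^ 2) * ?d (2 * j)"
      using lam by (simp add: field_simps)
    consider "j < l" | "j = l" | "l < j" by linarith
    then show ?case
    proof cases
      case 1
      define a where "a = real l - real j"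
      have a: "a > 0" using 1 by (simp add: a_def)
      have f1: "fact (l - j) = a * fact (l - Suc j)"
        using 1 by (simp add: fact_reduce of_nat_diff a_def)
      have f2: "fact (l + Suc j) = (real l + real j + 1) * fact (l + j)"
        by simp
      have f3: "(2 / lam) ^ (2 * Suc j + 1) = 4 / lam ^ 2 * (2 / lam) ^ (2 * j + 1)"
        by (simp add: power2_eq_square)
      have "4 * a * (real l + real j + 1) / lam ^ 2 * (1 / 2 * (fact (l + j) / fact (l - j)) * (2 / lam) ^ (2 * j + 1)) =
          1 / 2 * (fact (l + Suc j) / fact (l - Suc j)) * (2 / lam) ^ (2 * Suc j + 1)"
        unfolding f1 f2 f3 using a by (simp add: mult_ac)
      then show ?thesis using 1 unfolding step Suc.IH a_def
        by (simp only: of_real_mult[symmetric] less_imp_le if_True Suc_leI)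
    next
      case 2
      then show ?thesis unfolding step Suc.IH by simp
    next
      case 3
      then show ?thesis unfolding step Suc.IH by simp
    qed
  qed
qed

subsection \<open>Analytic continuation in the Laplace variable\<close>

text \<open>Cauchy's inequality on circles of radius \<open>r\<close> costs
  \<open>fact k / r ^ k\<close>, which the coefficient bound turns into a geometric series of ratio
  \<open>\<rho> / r\<close>. Shrinking the strip by \<open>r\<close> keeps those circles in the
  domain of \<open>f\<close>.\<close>

lemma higher_deriv_series_holomorphic:
  fixes c :: "nat \<Rightarrow> complex"
  assumes f: "f holomorphic_on {s. \<bar>Im s\<bar> < lam}"
    and \<rho>: "0 < \<rho>" "\<rho> < r" and c: "\<And>k. norm (c k) * fact k \<le> C * \<rho> ^ k"
  shows "(\<lambda>s. \<Sum>k. c k * (deriv ^^ k) f s) holomorphic_on {s. \<bar>Im s\<bar> < lam - r}"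
proof (rule holomorphic_uniform_sequence[OF open_strip])
  show "(\<lambda>s. \<Sum>k<N. c k * (deriv ^^ k) f s) holomorphic_on {s. \<bar>Im s\<bar> < lam - r}" for N
    by (rule holomorphic_on_subset[of _ "{s. \<bar>Im s\<bar> < lam}"])
       (use \<rho> in \<open>auto intro!: holomorphic_intros f open_strip\<close>)
  fix x assume "x \<in> {s. \<bar>Im s\<bar> < lam - r}"
  \<comment> \<open>Half the distance from \<open>x\<close> to the boundary of the smaller strip, so
    that even \<open>cball x (d + r)\<close> stays inside the larger one.\<close>
  define d where "d = (lam - r - \<bar>Im x\<bar>) / 2"
  have d: "0 < d" "\<bar>Im x\<bar> + d < lam - r" using \<open>x \<in> _\<close> by (auto simp: d_def field_simps)
  have Im_le: "\<bar>Im z\<bar> \<le> \<bar>Im x\<bar> + e" if "z \<in> cball x e" for z e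
    using that abs_Im_le_cmod[of "x - z"] by (simp add: dist_norm)
  have sub: "cball x d \<subseteq> {s. \<bar>Im s\<bar> < lam - r}"
    using d Im_le[of _ d] by fastforce
  have subK: "cball x (d + r) \<subseteq> {s. \<bar>Im s\<bar> < lam}"
    using d Im_le[of _ "d + r"] by fastforce
  have "continuous_on (cball x (d + r)) f"
    using f subK by (meson holomorphic_on_imp_continuous_on continuous_on_subset)
  then have "bounded (f ` cball x (d + r))"
    by (intro compact_imp_bounded compact_continuous_image) auto
  then obtain M where M: "0 < M" "\<And>z. z \<in> cball x (d + r) \<Longrightarrow> norm (f z) \<le> M"
    unfolding bounded_pos by auto
  have sub_ball: "cball z r \<subseteq> cball x (d + r)" if "z \<in> cball x d" for z
    using that by (auto simp: subset_eq) (metis add.commute add_mono dist_triangle order_trans)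
  have bound: "norm (c k * (deriv ^^ k) f z) \<le> C * M * (\<rho> / r) ^ k" if z: "z \<in> cball x d" for z k
  proof -
    have "norm ((deriv ^^ k) f z) \<le> fact k * M / r ^ k"
    proof (rule Cauchy_inequality)
      show "f holomorphic_on ball z r"
        using f sub_ball[OF z] subK ball_subset_cball by (meson holomorphic_on_subset order_trans)
      show "continuous_on (cball z r) f"
        using \<open>continuous_on (cball x (d + r)) f\<close> sub_ball[OF z] by (rule continuous_on_subset)
      show "norm (f w) \<le> M" if "norm (z - w) = r" for w
        using M(2) sub_ball[OF z] that by (auto simp: dist_norm)
    qed (use \<rho> in simp)
    then have "norm (c k) * norm ((deriv ^^ k) f z) \<le> norm (c k) * (fact k * M / r ^ k)"
      by (rule mult_left_mono) simp
    also have "\<dots> = norm (c k) * fact k * (M / r ^ k)" by simp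
    also have "\<dots> \<le> C * \<rho> ^ k * (M / r ^ k)"
      using M(1) \<rho> by (intro mult_right_mono c) auto
    also have "\<dots> = C * M * (\<rho> / r) ^ k" by (simp add: power_divide)
    finally show ?thesis by (simp add: norm_mult)
  qed
  have "summable (\<lambda>k. C * M * (\<rho> / r) ^ k)"
    using \<rho> by (intro summable_mult summable_geometric) auto
  then have "uniform_limit (cball x d) (\<lambda>N s. \<Sum>k<N. c k * (deriv ^^ k) f s) (\<lambda>s. \<Sum>k. c k * (deriv ^^ k) f s) sequentially"
    by (intro Weierstrass_m_test[OF bound])
  with d(1) sub show "\<exists>d>0. cball x d \<subseteq> {s. \<bar>Im s\<bar> < lam - r} \<and>
      uniform_limit (cball x d) (\<lambda>N s. \<Sum>k<N. c k * (deriv ^^ k) f s) (\<lambda>s. \<Sum>k. c k * (deriv ^^ k) f s) sequentially"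
    by blast
qed

text \<open>Dominated convergence with majorant \<open>norm (f x)\<close>, along a sequence of
  positive reals tending to 0.\<close>

lemma laplace_tendsto_integral:
  assumes f: "f absolutely_integrable_on {0..}"
  shows "(\<lambda>N. laplace f (of_real (1 / real (Suc N)))) \<longlonglongrightarrow> integral {0..} f"
  unfolding laplace_def
proof (rule dominated_convergence(2))
  let ?g = "\<lambda>N x. exp (- complex_of_real (1 / real (Suc N)) * of_real x) * f x"
  show "?g N integrable_on {0..}" for N
    by (rule set_lebesgue_integral_eq_integral(1)[OF laplace_absolutely_integrable[OF f]]) simp
  show "(\<lambda>x. norm (f x)) integrable_on {0..}"
    using f by (simp add: absolutely_integrable_on_def)
  show "norm (?g N x) \<le> norm (f x)" if "x \<in> {0..}" for N x
    using that by (simp add: norm_mult mult_left_le_one_le)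
  show "(\<lambda>N. ?g N x) \<longlonglongrightarrow> f x" for x
  proof -
    have "(\<lambda>N. 1 / real (Suc N)) \<longlonglongrightarrow> 0"
      using LIMSEQ_inverse_real_of_nat by (simp add: inverse_eq_divide)
    then have "(\<lambda>N. ?g N x) \<longlonglongrightarrow> exp (- complex_of_real 0 * of_real x) * f x"
      by (intro tendsto_intros)
    then show ?thesis by simp
  qed
qed

text \<open>The termwise formula is available for large real arguments only, the integral is wanted
  at 0; a half-strip on which both sides are holomorphic connects the two.\<close>

lemma integral_mult_bessel_J:
  fixes h :: "real \<Rightarrow> complex" and c :: "nat \<Rightarrow> complex"
  assumes h: "h absolutely_integrable_on {0..}"
    and hc: "\<And>x. h x = (\<Sum>k. c k * of_real x ^ k)"
    and c: "\<And>k. norm (c k) * fact k \<le> C * \<rho> ^ k"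
    and \<rho>: "0 < \<rho>" "\<rho> < lam"
  shows "((\<lambda>x. h x * bessel_J n (of_real (lam * x))) has_integral
           (\<Sum>k. c k * (- 1) ^ k * (deriv ^^ k) (bessel_laplace n lam) 0)) {0..}"
proof -
  have lam: "0 < lam" using \<rho> by simp
  define J where "J = (\<lambda>x. bessel_J n (of_real (lam * x)))"
  define f where "f = (\<lambda>x. J x * h x)"
  define L where "L = bessel_laplace n lam"
  define R where "R = (\<lambda>s. \<Sum>k. c k * (- 1) ^ k * (deriv ^^ k) L s)"
  have J: "continuous_on {0..} J" "norm (J x) \<le> 1" for x
    unfolding J_def by (rule continuous_on_bessel_J, rule norm_bessel_J_le_1)
  have f: "f absolutely_integrable_on {0..}"
    unfolding f_def by (rule absolutely_integrable_bounded_continuous_mult[OF h J])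
  have eq_large: "laplace f (of_real t) = R (of_real t)" if t: "lam < t" for t
  proof -
    \<comment> \<open>Since \<open>t > lam > \<rho>\<close>, the Laplace kernel absorbs the weight
      \<open>exp (\<rho> * x)\<close> required for termwise integration.\<close>
    have "(\<lambda>x. J x * of_real (exp (- (t - \<rho>) * x))) absolutely_integrable_on {0..}"
      by (rule absolutely_integrable_bounded_continuous_mult[OF absolutely_integrable_exp_minus J]) (use t \<rho> in simp)
    moreover have "of_real (exp (\<rho> * x)) * (exp (- of_real t * of_real x) * J x) = J x * of_real (exp (- (t - \<rho>) * x))" for x
      unfolding exp_of_real[symmetric] by (simp add: mult_exp_exp algebra_simps flip: mult.assoc)
    ultimately have int: "(\<lambda>x. of_real (exp (\<rho> * x)) * (exp (- of_real t * of_real x) * J x)) absolutely_integrable_on {0..}"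
      by (simp only:)
    have "(\<lambda>k. c k * ((- 1) ^ k * (deriv ^^ k) L (of_real t))) sums
        integral {0..} (\<lambda>x. (\<Sum>k. c k * of_real x ^ k) * (exp (- of_real t * of_real x) * J x))"
      using sums_integral_moments(2)[OF int \<rho>(1) c] moment_bessel_J[OF lam t, of _ n]
      unfolding J_def L_def by (simp only:)
    moreover have "(\<Sum>k. c k * of_real x ^ k) * (exp (- of_real t * of_real x) * J x) = exp (- of_real t * of_real x) * f x" for x
      unfolding f_def hc by (simp only: mult_ac)
    ultimately show ?thesis unfolding laplace_def R_def by (simp only: sums_iff mult.assoc)
  qed
  define r where "r = (lam + \<rho>) / 2"
  have r: "\<rho> < r" "r < lam" using \<rho> by (auto simp: r_def)
  have R: "R holomorphic_on {s. \<bar>Im s\<bar> < lam - r}"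
    unfolding R_def
    by (rule higher_deriv_series_holomorphic[OF _ \<rho>(1) r(1), where C = C])
       (use c in \<open>auto simp: L_def norm_mult norm_power intro: bessel_laplace_holomorphic[OF lam]\<close>)
  define S where "S = {z. 0 < Re z} \<inter> ({z. - (lam - r) < Im z} \<inter> {z. Im z < lam - r})"
  have S: "open S" "convex S"
    unfolding S_def
    by (intro open_Int open_halfspace_Re_gt open_halfspace_Im_gt open_halfspace_Im_lt)
       (intro convex_Int convex_halfspace_Re_gt convex_halfspace_Im_gt convex_halfspace_Im_lt)
  have eq: "laplace f z = R z" if "z \<in> S" for z
  proof (rule holomorphic_eq_of_eq_on_half_line[OF _ _ S _ _ that, where a = lam])
    show "laplace f (of_real u) = R (of_real u)" if "lam < u" for u by (rule eq_large[OF that])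
    show "laplace f holomorphic_on S"
      by (rule holomorphic_on_subset[OF laplace_holomorphic[OF f]]) (auto simp: S_def)
    show "R holomorphic_on S"
      by (rule holomorphic_on_subset[OF R]) (auto simp: S_def)
    show "of_real ` {lam<..} \<subseteq> S" using lam r by (auto simp: S_def)
  qed
  \<comment> \<open>The origin lies on the boundary of \<open>S\<close> but inside the strip where
    \<open>R\<close> is holomorphic, so both sides have a limit there.\<close>
  have "laplace f (of_real (1 / real (Suc N))) = R (of_real (1 / real (Suc N)))" for N
    by (rule eq) (use r in \<open>simp add: S_def del: of_real_divide\<close>)
  moreover have "(\<lambda>N. R (of_real (1 / real (Suc N)))) \<longlonglongrightarrow> R (of_real 0)"
  proof (rule isCont_tendsto_compose[of _ R])
    show "isCont R (of_real 0)"
      using holomorphic_on_imp_continuous_on[OF R] r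
      by (simp add: continuous_on_eq_continuous_at[OF open_strip])
    show "(\<lambda>N. complex_of_real (1 / real (Suc N))) \<longlonglongrightarrow> of_real 0"
      using LIMSEQ_inverse_real_of_nat by (intro tendsto_of_real) (simp add: inverse_eq_divide)
  qed
  ultimately have "integral {0..} f = R 0"
    using LIMSEQ_unique[OF laplace_tendsto_integral[OF f]] by simp
  moreover have "f integrable_on {0..}"
    by (rule set_lebesgue_integral_eq_integral(1)[OF f])
  ultimately have "(f has_integral R 0) {0..}" by (simp add: has_integral_iff)
  then show ?thesis by (simp add: f_def J_def R_def L_def mult.commute)
qed

subsection \<open>Even entire functions of exponential type\<close>

lemma entire_of_exp_type_bound:
  assumes h: "entire_of_exp_type h \<tau>" and \<sigma>: "\<tau> < \<sigma>"
  obtains M where "0 < M" "\<And>z. norm (h z) \<le> M * exp (\<sigma> * norm z)"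
proof -
  have "0 \<le> \<tau>" and hol: "h holomorphic_on UNIV" using h by (auto simp: entire_of_exp_type_def)
  have "\<forall>\<^sub>F z in at_infinity. norm (h z) \<le> exp ((\<tau> + (\<sigma> - \<tau>)) * norm z)"
    using h \<sigma> unfolding entire_of_exp_type_def by (metis diff_gt_0_iff_gt)
  then obtain B where B: "\<And>z. B \<le> norm z \<Longrightarrow> norm (h z) \<le> exp (\<sigma> * norm z)"
    by (auto simp: eventually_at_infinity)
  have "bounded (h ` cball 0 B)"
    using holomorphic_on_imp_continuous_on[OF hol]
    by (intro compact_imp_bounded compact_continuous_image) (auto elim: continuous_on_subset)
  then obtain M where M: "0 < M" "\<And>z. norm z \<le> B \<Longrightarrow> norm (h z) \<le> M"
    unfolding bounded_pos by auto
  have "norm (h z) \<le> max M 1 * exp (\<sigma> * norm z)" for z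
  proof (cases "norm z \<le> B")
    case True
    have "M * 1 \<le> max M 1 * exp (\<sigma> * norm z)"
      using \<open>0 \<le> \<tau>\<close> \<sigma> M(1) by (intro mult_mono) auto
    then show ?thesis using M(2)[OF True] by simp
  next
    case False
    have "1 * exp (\<sigma> * norm z) \<le> max M 1 * exp (\<sigma> * norm z)" by (intro mult_right_mono) auto
    then show ?thesis using B[of z] False by linarith
  qed
  then show ?thesis by (intro that[of "max M 1"]) auto
qed

text \<open>Cauchy's inequality gives \<open>norm (c k) * r ^ k \<le> M * exp (\<sigma> * r)\<close>
  for every radius. Multiplying by \<open>exp (- \<rho> * r)\<close> and integrating over
  \<open>r\<close> produces the factorial, with no need to optimise the radius.\<close>

lemma exp_type_coeff_bound:
  assumes h: "entire_of_exp_type h \<tau>" and \<rho>: "\<tau> < \<rho>"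
    and c: "\<And>z. (\<lambda>k. c k * z ^ k) sums h z"
  obtains C where "\<And>k. norm (c k) * fact k \<le> C * \<rho> ^ k"
proof -
  have hol: "h holomorphic_on UNIV" and "0 \<le> \<tau>" using h by (auto simp: entire_of_exp_type_def)
  \<comment> \<open>Strictly between: above the type for a global bound on \<open>h\<close>, below
    \<open>\<rho>\<close> so that \<open>exp (- (\<rho> - \<sigma>) * r)\<close> is
    integrable.\<close>
  define \<sigma> where "\<sigma> = (\<tau> + \<rho>) / 2"
  have \<sigma>: "\<tau> < \<sigma>" "\<sigma> < \<rho>" using \<rho> by (auto simp: \<sigma>_def)
  obtain M where M: "0 < M" "\<And>z. norm (h z) \<le> M * exp (\<sigma> * norm z)"
    using entire_of_exp_type_bound[OF h \<sigma>(1)] by blast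
  have "h has_fps_expansion Abs_fps c"
    by (rule has_fps_expansionI) (simp add: c)
  from fps_nth_fps_expansion[OF this] have deriv_eq: "(deriv ^^ k) h 0 = fact k * c k" for k by simp
  have cauchy: "norm (c k) * r ^ k \<le> M * exp (\<sigma> * r)" if r: "0 < r" for k r
  proof -
    have "norm ((deriv ^^ k) h 0) \<le> fact k * (M * exp (\<sigma> * r)) / r ^ k"
    proof (rule Cauchy_inequality)
      show "continuous_on (cball 0 r) h"
        using holomorphic_on_imp_continuous_on[OF hol] by (rule continuous_on_subset) simp
      show "norm (h x) \<le> M * exp (\<sigma> * r)" if "norm (0 - x) = r" for x
        using M(2)[of x] that by simp
    qed (use hol r in \<open>auto intro: holomorphic_on_subset\<close>)
    then show ?thesis using r by (simp add: deriv_eq norm_mult field_simps)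
  qed
  have "norm (c k) * fact k \<le> M * \<rho> / (\<rho> - \<sigma>) * \<rho> ^ k" for k
  proof -
    have "((\<lambda>r. norm (c k) * (r ^ k * exp (- \<rho> * r))) has_integral norm (c k) * (fact k / \<rho> ^ Suc k)) {0..}"
      using \<open>0 \<le> \<tau>\<close> \<rho> by (intro has_integral_mult_right has_integral_power_times_exp) auto
    \<comment> \<open>The endpoint 0 is dropped as a null set because \<open>cauchy\<close> holds
      for positive radii only.\<close>
    then have i1: "((\<lambda>r. norm (c k) * (r ^ k * exp (- \<rho> * r))) has_integral norm (c k) * (fact k / \<rho> ^ Suc k)) {0<..}"
      by (rule has_integral_spike_set_eq[THEN iffD1, rotated 2]) 
         (auto intro: negligible_subset[of "{0}"])
    have "((\<lambda>r. M * exp (- (\<rho> - \<sigma>) * r)) has_integral M * (exp (- (\<rho> - \<sigma>) * 0) / (\<rho> - \<sigma>))) {0..}"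
      using \<sigma> by (intro has_integral_mult_right has_integral_exp_minus_to_infinity) auto
    then have i2: "((\<lambda>r. M * exp (- (\<rho> - \<sigma>) * r)) has_integral M * (exp (- (\<rho> - \<sigma>) * 0) / (\<rho> - \<sigma>))) {0<..}"
      by (rule has_integral_spike_set_eq[THEN iffD1, rotated 2]) 
         (auto intro: negligible_subset[of "{0}"])
    have "norm (c k) * (fact k / \<rho> ^ Suc k) \<le> M * (exp (- (\<rho> - \<sigma>) * 0) / (\<rho> - \<sigma>))"
    proof (rule has_integral_le[OF i1 i2])
      fix r :: real assume "r \<in> {0<..}"
      then have "norm (c k) * r ^ k * exp (- \<rho> * r) \<le> M * exp (\<sigma> * r) * exp (- \<rho> * r)"
        by (intro mult_right_mono cauchy) auto
      also have "\<dots> = M * exp (- (\<rho> - \<sigma>) * r)"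
        by (simp add: mult_exp_exp algebra_simps)
      finally show "norm (c k) * (r ^ k * exp (- \<rho> * r)) \<le> M * exp (- (\<rho> - \<sigma>) * r)" by (simp only: mult.assoc)
    qed
    then show ?thesis using \<sigma> \<rho> \<open>0 \<le> \<tau>\<close> by (simp add: field_simps)
  qed
  then show ?thesis by (rule that)
qed

text \<open>With \<open>u = z ^ 2\<close> the series is an ordinary power series \<open>F u\<close>,
  convergent everywhere because each nonzero \<open>u\<close> has the root \<open>csqrt u\<close>;
  continuity of \<open>F\<close> at 0 gives the limit.\<close>

lemma even_power_series_tendsto_0:
  fixes a :: "nat \<Rightarrow> complex"
  assumes a: "\<And>z. z \<noteq> 0 \<Longrightarrow> (\<lambda>j. a j * z ^ (2 * j)) sums g z"
  shows "(g \<longlongrightarrow> a 0) (at 0)"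
proof -
  define F where "F = (\<lambda>u. \<Sum>j. a j * u ^ j)"
  have F: "(\<lambda>j. a j * u ^ j) sums F u" for u
  proof (cases "u = 0")
    case False
    then have "summable (\<lambda>j. a j * csqrt u ^ (2 * j))" using a[of "csqrt u"] by (auto simp: sums_iff)
    then show ?thesis unfolding F_def by (intro summable_sums) (simp add: power_mult)
  qed (simp add: F_def)
  have "(F \<longlongrightarrow> a 0) (at 0)"
    by (rule powser_limit_0[of 1]) (use F in auto)
  moreover have "F 0 = a 0" using F[of 0] by simp
  ultimately have "isCont F 0" by (simp add: isCont_def)
  then have "((\<lambda>z. F (z ^ 2)) \<longlongrightarrow> F 0) (at 0)"
    by (rule isCont_tendsto_compose[of _ F]) (auto intro!: tendsto_eq_intros)
  then have lim: "((\<lambda>z. F (z ^ 2)) \<longlongrightarrow> a 0) (at 0)" using \<open>F 0 = a 0\<close> by simp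
  have "F (z ^ 2) = g z" if "z \<noteq> 0" for z
    using F[of "z ^ 2"] a[OF that] by (simp add: power_mult sums_iff)
  then show ?thesis
    by (intro Lim_transform_within[OF lim zero_less_one]) auto
qed

section \<open>Evaluation of the integral from the expansion of \<open>h\<close>\<close>

theorem theorem2:
  fixes h :: "complex \<Rightarrow> complex" and b :: "nat \<Rightarrow> complex"
    and \<tau> lam :: real and l :: nat and m :: int
  assumes "entire_of_exp_type h \<tau>"
    and "(\<lambda>x::real. h (of_real x)) absolutely_integrable_on {0..}"
    and "0 \<le> m + int l"
    and "b 0 \<noteq> 0"
    and "\<And>z. z \<noteq> 0 \<Longrightarrow> summable (\<lambda>j. b j * z ^ (2 * j))"
    and "\<And>z. z \<noteq> 0 \<Longrightarrow> h z = z powi (2 * m) * (\<Sum>j. b j * z ^ (2 * j))"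
    and "0 < lam"
    and "\<tau> < lam"
  shows "(int l < m \<longrightarrow>
            ((\<lambda>x::real. h (of_real x) * bessel_J (2 * l + 1) (of_real (lam * x)))
               has_integral 0) {0..}) \<and>
         (m \<le> int l \<longrightarrow>
            ((\<lambda>x::real. h (of_real x) * bessel_J (2 * l + 1) (of_real (lam * x)))
               has_integral
                 (1 / 2 * (\<Sum>j = 0..nat (int l - m).
                    b j * (fact (nat (int l + m + int j)) / fact (nat (int l - m - int j)))
                        * of_real ((2 / lam) powi (2 * m + 2 * int j + 1))))) {0..})"
proof -
  have hol: "h holomorphic_on UNIV" and "0 \<le> \<tau>"
    using assms(1) by (auto simp: entire_of_exp_type_def)
  have "isCont h 0"
    using holomorphic_on_imp_continuous_on[OF hol] by (simp add: continuous_on_eq_continuous_at)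
  then have h_lim: "(h \<longlongrightarrow> h 0) (at 0)" by (simp add: isCont_def)
  have b_lim: "((\<lambda>z. \<Sum>j. b j * z ^ (2 * j)) \<longlongrightarrow> b 0) (at 0)"
    by (rule even_power_series_tendsto_0) (use assms(5) in \<open>auto intro: summable_sums\<close>)
  \<comment> \<open>For negative \<open>m\<close> the function \<open>z ^ p * h z\<close> would tend
    to 0 at the origin, yet it equals the series, whose limit is \<open>b 0\<close>.\<close>
  have "0 \<le> m"
  proof (rule ccontr)
    assume "\<not> 0 \<le> m"
    define p where "p = nat (- (2 * m))"
    have p: "2 * m = - int p" "p > 0" using \<open>\<not> 0 \<le> m\<close> by (auto simp: p_def)
    have "((\<lambda>z. z ^ p * h z) \<longlongrightarrow> 0 ^ p * h 0) (at 0)"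
      by (intro tendsto_mult h_lim tendsto_power tendsto_ident_at)
    then have "((\<lambda>z. \<Sum>j. b j * z ^ (2 * j)) \<longlongrightarrow> 0 ^ p * h 0) (at 0)"
    proof (rule Lim_transform_within[of _ _ _ _ 1])
      fix z :: complex assume "0 < dist z 0"
      then have "z \<noteq> 0" by simp
      then show "z ^ p * h z = (\<Sum>j. b j * z ^ (2 * j))"
        using assms(6)[of z] unfolding p(1) by (simp add: power_int_minus field_simps)
    qed simp
    then have "0 ^ p * h 0 = b 0"
      by (rule tendsto_unique[OF at_neq_bot _ b_lim])
    with p(2) assms(4) show False by (simp add: zero_power)
  qed
  define M where "M = nat m"
  have M: "m = int M" using \<open>0 \<le> m\<close> by (simp add: M_def)
  \<comment> \<open>Absorbs the factor \<open>z ^ (2 * M)\<close> into the coefficients.\<close>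
  define a where "a = (\<lambda>j. if j < M then 0 else b (j - M))"
  have a_sums: "(\<lambda>j. a j * z ^ (2 * j)) sums h z" if z: "z \<noteq> 0" for z
  proof -
    have "(\<lambda>j. z ^ (2 * M) * (b j * z ^ (2 * j))) sums (z ^ (2 * M) * (\<Sum>j. b j * z ^ (2 * j)))"
      by (intro sums_mult summable_sums assms(5) z)
    moreover have "z powi (2 * m) = z ^ (2 * M)"
      unfolding M using power_int_of_nat[of z "2 * M"] by simp
    ultimately have "(\<lambda>j. z ^ (2 * M) * (b j * z ^ (2 * j))) sums h z"
      using assms(6)[OF z] by simp
    moreover have "a (j + M) * z ^ (2 * (j + M)) = z ^ (2 * M) * (b j * z ^ (2 * j))" for j
      by (simp add: a_def power_add)
    moreover have "(\<lambda>j. a (j + M) * z ^ (2 * (j + M))) sums h z \<longleftrightarrow> (\<lambda>j. a j * z ^ (2 * j)) sums h z"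
      by (rule sums_zero_iff_shift) (simp add: a_def)
    ultimately show ?thesis by (simp only:)
  qed
  \<comment> \<open>The expansion is assumed away from 0 only; at 0 it follows by comparing
    limits.\<close>
  have "h 0 = a 0"
    by (rule tendsto_unique[OF at_neq_bot h_lim even_power_series_tendsto_0[OF a_sums]])
  then have a_sums: "(\<lambda>j. a j * z ^ (2 * j)) sums h z" for z
    using a_sums[of z] powser_sums_zero[of a] by (cases "z = 0") (auto simp: power_mult)
  define c where "c = (\<lambda>k. if even k then a (k div 2) else 0)"
  have c_sums: "(\<lambda>k. c k * z ^ k) sums h z" for z
  proof -
    have "(\<lambda>j. c (2 * j) * z ^ (2 * j)) sums h z" using a_sums by (simp add: c_def)
    then show ?thesis
      by (subst (asm) sums_mono_reindex[of "\<lambda>j. 2 * j" "\<lambda>k. c k * z ^ k"])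
         (auto simp: strict_mono_def c_def elim!: evenE)
  qed
  define \<rho> where "\<rho> = (\<tau> + lam) / 2"
  have \<rho>: "0 < \<rho>" "\<tau> < \<rho>" "\<rho> < lam" using assms(7,8) \<open>0 \<le> \<tau>\<close> by (auto simp: \<rho>_def)
  obtain C where C: "\<And>k. norm (c k) * fact k \<le> C * \<rho> ^ k"
    using exp_type_coeff_bound[OF assms(1) \<rho>(2) c_sums] by blast
  \<comment> \<open>For \<open>j \<le> l\<close> this is the derivative of order
    \<open>2 * j\<close> at 0 of the Laplace transform. The series below becomes finite: odd
    \<open>k\<close> drop out through \<open>c\<close>, even \<open>k\<close> beyond
    \<open>2 * l\<close> through that derivative.\<close>
  define w where "w = (\<lambda>j. 1 / 2 * (fact (l + j) / fact (l - j)) * (2 / lam) ^ (2 * j + 1))"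
  have "(\<Sum>k. c k * (- 1) ^ k * (deriv ^^ k) (bessel_laplace (2 * l + 1) lam) 0) = (\<Sum>j\<le>l. a j * of_real (w j))"
  proof -
    let ?t = "\<lambda>k. c k * (- 1) ^ k * (deriv ^^ k) (bessel_laplace (2 * l + 1) lam) 0"
    have t: "?t (2 * j) = (if j \<le> l then a j * of_real (w j) else 0)" for j
      unfolding higher_deriv_bessel_laplace_0[OF assms(7)] by (simp add: c_def w_def)
    have "(\<lambda>j. if j \<in> {..l} then a j * of_real (w j) else 0) sums (\<Sum>j\<le>l. a j * of_real (w j))"
      by (rule sums_If_finite_set) simp
    then have "(\<lambda>j. ?t (2 * j)) sums (\<Sum>j\<le>l. a j * of_real (w j))" unfolding t by simp
    then have "?t sums (\<Sum>j\<le>l. a j * of_real (w j))"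
      by (subst (asm) sums_mono_reindex[of "\<lambda>j. 2 * j" ?t])
         (auto simp: strict_mono_def c_def elim!: evenE)
    then show ?thesis by (simp add: sums_iff)
  qed
  moreover have "h (of_real x) = (\<Sum>k. c k * of_real x ^ k)" for x using c_sums by (simp add: sums_iff)
  ultimately have main: "((\<lambda>x::real. h (of_real x) * bessel_J (2 * l + 1) (of_real (lam * x))) has_integral
      (\<Sum>j\<le>l. a j * of_real (w j))) {0..}"
    using integral_mult_bessel_J[OF assms(2) _ C \<rho>(1,3), of "2 * l + 1"] by simp
  show ?thesis
  proof (intro conjI impI)
    assume "int l < m"
    then have "(\<Sum>j\<le>l. a j * of_real (w j)) = 0" by (intro sum.neutral) (simp add: a_def M)
    with main show "((\<lambda>x::real. h (of_real x) * bessel_J (2 * l + 1) (of_real (lam * x))) has_integral 0) {0..}"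
      by simp
  next
    assume "m \<le> int l"
    then have "M \<le> l" by (simp add: M)
    have "(\<Sum>j\<le>l. a j * of_real (w j)) = (\<Sum>j = M..l. b (j - M) * of_real (w j))"
      using \<open>M \<le> l\<close> by (intro sum.mono_neutral_cong_right) (auto simp: a_def)
    \<comment> \<open>The shift by \<open>M\<close> turns \<open>l + j\<close> and
      \<open>l - j\<close> in \<open>w\<close> into the factorial arguments of the claim.\<close>
    also have "\<dots> = (\<Sum>j = 0..l - M. b j * of_real (w (j + M)))"
      using \<open>M \<le> l\<close> sum.shift_bounds_cl_nat_ivl[of "\<lambda>j. b (j - M) * of_real (w j)" 0 M "l - M"] by simp
    also have "\<dots> = (\<Sum>j = 0..l - M. 1 / 2 * (b j * (fact (nat (int l + m + int j)) / fact (nat (int l - m - int j)))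
        * of_real ((2 / lam) powi (2 * m + 2 * int j + 1))))"
    proof (rule sum.cong[OF refl])
      fix j assume "j \<in> {0..l - M}"
      then have "nat (int l + m + int j) = l + (j + M)" "nat (int l - m - int j) = l - (j + M)"
        by (auto simp: M)
      moreover have "(2 / lam) powi (2 * m + 2 * int j + 1) = (2 / lam) ^ (2 * (j + M) + 1)"
      proof -
        have "2 * m + 2 * int j + 1 = int (2 * (j + M) + 1)" by (simp add: M)
        then show ?thesis by (simp only: power_int_of_nat)
      qed
      ultimately show "b j * of_real (w (j + M)) = 1 / 2 * (b j * (fact (nat (int l + m + int j)) / fact (nat (int l - m - int j)))
        * of_real ((2 / lam) powi (2 * m + 2 * int j + 1)))"
        by (simp only: w_def) simp
    qed
    also have "\<dots> = 1 / 2 * (\<Sum>j = 0..nat (int l - m). b j * (fact (nat (int l + m + int j)) / fact (nat (int l - m - int j)))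
        * of_real ((2 / lam) powi (2 * m + 2 * int j + 1)))"
    proof -
      have "nat (int l - m) = l - M" by (simp add: M)
      then show ?thesis by (simp only: sum_distrib_left)
    qed
    finally show "((\<lambda>x::real. h (of_real x) * bessel_J (2 * l + 1) (of_real (lam * x)))
               has_integral
                 (1 / 2 * (\<Sum>j = 0..nat (int l - m).
                    b j * (fact (nat (int l + m + int j)) / fact (nat (int l - m - int j)))
                        * of_real ((2 / lam) powi (2 * m + 2 * int j + 1))))) {0..}"
      using main by (simp only:)
  qed
qed

end
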